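(* Assume (FWW) for a flow $\Phi_t$ on $\mathbb{R}^n$ and a $k$-cone $C$. Let $\mathcal{D}\subset\mathbb{R}^n$ be an open bounded set whose orbit set $\mathcal{O}(\mathcal{D})=\bigcup_{x\in\mathcal{D}}\{\Phi_t(x):t\ge0\}$ is bounded. Then $\operatorname{Int}(Q\cup C_E)$ (interior in $\mathbb{R}^n$) is dense in $\mathcal{D}$.
   Context: A closed set $C\subset\mathbb{R}^n$ is a $k$-cone if $lv\in C$ for all $v\in C$, $l\in\mathbb{R}$, and the maximal dimension of a linear subspace contained in $C$ is $k$. $C$ is $k$-solid if there is a $k$-dimensional subspace $W$ with $W\setminus\{0\}\subset\operatorname{Int}C$. Write $x\sim y$ if $x-y\in C$ and $x\approx y$ if $x-y\in\operatorname{Int}C$. A flow $\Phi_t$ is strongly monotone with respect to a $k$-solid cone $C$ if $x\sim y$ implies $\Phi_t(x)\sim\Phi_t(y)$ for $t\ge0$, and $x\ne y$, $x\sim y$ imply $\Phi_t(x)\approx\Phi_t(y)$ for $t>0$. Assumption (FWW): the flow $\Phi_t$ on $\mathbb{R}^n$ is $C^{1,\alpha}$-smooth ($C^1$ with locally $\alpha$-Hölder derivative, $\alpha\in(0,1]$), strongly monotone with respect to the $k$-cone $C$, and $D_x\Phi_t(C\setminus\{0\})\subset\operatorname{Int}C$ for all $t>0$. A nontrivial orbit $O(x)=\{\Phi_t(x):t\ge0\}$ is pseudo-ordered if it contains two distinct points $\Phi_{t_1}(x)\sim\Phi_{t_2}(x)$; $Q$ is the set of $x$ whose orbit is pseudo-ordered.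 $C_E$ is the set of $x$ whose orbit converges to an equilibrium. *)

theory Defs
  imports "HOL-Analysis.Analysis"
begin

definition is_flow :: "(real \<Rightarrow> real^'n \<Rightarrow> real^'n) \<Rightarrow> bool" where
  "is_flow \<Phi> \<longleftrightarrow>
     (\<forall>x. \<Phi> 0 x = x) \<and>
     (\<forall>s t x. \<Phi> (s + t) x = \<Phi> s (\<Phi> t x)) \<and>
     continuous_on UNIV (\<lambda>(t, x). \<Phi> t x)"

definition C1_alpha_flow ::
  "(real \<Rightarrow> real^'n \<Rightarrow> real^'n) \<Rightarrow> (real \<Rightarrow> real^'n \<Rightarrow> ((real^'n) \<Rightarrow>\<^sub>L (real^'n))) \<Rightarrow> real \<Rightarrow> bool" where
  "C1_alpha_flow \<Phi> D \<alpha> \<longleftrightarrow>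
     is_flow \<Phi> \<and> 0 < \<alpha> \<and> \<alpha> \<le> 1 \<and>
     (\<forall>t x. (\<Phi> t has_derivative blinfun_apply (D t x)) (at x)) \<and>
     continuous_on UNIV (\<lambda>(t, x). D t x) \<and>
     (\<forall>T K. compact T \<and> compact K \<longrightarrow>
        (\<exists>L. \<forall>t\<in>T. \<forall>x\<in>K. \<forall>y\<in>K. norm (D t x - D t y) \<le> L * dist x y powr \<alpha>))"

definition k_cone :: "nat \<Rightarrow> ('a::euclidean_space) set \<Rightarrow> bool" where
  "k_cone k C \<longleftrightarrow>
     closed C \<and> (\<forall>v\<in>C. \<forall>l::real. l *\<^sub>R v \<in> C) \<and>
     (\<exists>W. subspace W \<and> W \<subseteq> C \<and> dim W = k) \<and>
     (\<forall>W. subspace W \<and> W \<subseteq> C \<longrightarrow> dim W \<le> k)"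

definition k_solid :: "nat \<Rightarrow> ('a::euclidean_space) set \<Rightarrow> bool" where
  "k_solid k C \<longleftrightarrow> (\<exists>W. subspace W \<and> dim W = k \<and> W - {0} \<subseteq> interior C)"

definition strongly_monotone ::
  "(real \<Rightarrow> 'a::euclidean_space \<Rightarrow> 'a) \<Rightarrow> 'a set \<Rightarrow> bool" where
  "strongly_monotone \<Phi> C \<longleftrightarrow>
     (\<forall>x y t. x - y \<in> C \<and> 0 \<le> t \<longrightarrow> \<Phi> t x - \<Phi> t y \<in> C) \<and>
     (\<forall>x y t. x \<noteq> y \<and> x - y \<in> C \<and> 0 < t \<longrightarrow> \<Phi> t x - \<Phi> t y \<in> interior C)"

definition FWW ::
  "(real \<Rightarrow> real^'n \<Rightarrow> real^'n) \<Rightarrow> (real \<Rightarrow> real^'n \<Rightarrow> ((real^'n) \<Rightarrow>\<^sub>L (real^'n))) \<Rightarrow> real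
    \<Rightarrow> nat \<Rightarrow> (real^'n) set \<Rightarrow> bool" where
  "FWW \<Phi> D \<alpha> k C \<longleftrightarrow>
     C1_alpha_flow \<Phi> D \<alpha> \<and> k_cone k C \<and> k_solid k C \<and> strongly_monotone \<Phi> C \<and>
     (\<forall>t>0. \<forall>x. \<forall>v \<in> C - {0}. blinfun_apply (D t x) v \<in> interior C)"

definition orbit :: "(real \<Rightarrow> 'a \<Rightarrow> 'a) \<Rightarrow> 'a \<Rightarrow> 'a set" where
  "orbit \<Phi> x = {\<Phi> t x | t. 0 \<le> t}"

definition pseudo_ordered_set :: "(real \<Rightarrow> 'a::euclidean_space \<Rightarrow> 'a) \<Rightarrow> 'a set \<Rightarrow> 'a set" where
  "pseudo_ordered_set \<Phi> C =
     {x. \<exists>t1 t2. 0 \<le> t1 \<and> 0 \<le> t2 \<and> \<Phi> t1 x \<noteq> \<Phi> t2 x \<and> \<Phi> t1 x - \<Phi> t2 x \<in> C}"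

definition conv_equilibrium_set :: "(real \<Rightarrow> 'a::topological_space \<Rightarrow> 'a) \<Rightarrow> 'a set" where
  "conv_equilibrium_set \<Phi> =
     {x. \<exists>e. (\<forall>t. \<Phi> t e = e) \<and> ((\<lambda>t. \<Phi> t x) \<longlongrightarrow> e) at_top}"

end

theory Submission
  imports Defs
begin

text \<open>
  Let \<open>U \<subseteq> \<D>\<close> be open and disjoint from the open set \<open>Q\<close>. The velocity of the flow then vanishes
  or stays outside the interior of \<open>C\<close> along every orbit that starts in \<open>U\<close>, so by exponential
  separation it is at most a multiple of \<open>q\<^sup>t\<close> times the weakest expansion of vectors of \<open>C\<close> along the
  orbit, for some \<open>q < 1\<close>. Let \<open>W \<subseteq> C\<close> be a subspace of dimension \<open>k\<close> and \<open>P\<close> a projection onto \<open>W\<close>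
  whose kernel meets \<open>C\<close> only in 0. Points of the same coset of \<open>W\<close> remain ordered, hence
  \<open>x \<mapsto> P (\<Phi>\<^sub>t x) + (x - P x)\<close> is injective with bounded image, and the integral of its Jacobian
  over \<open>U\<close> is bounded uniformly in \<open>t\<close>. The Jacobian controls the weakest expansion of \<open>C\<close>, so for
  almost every \<open>x \<in> U\<close> this expansion is at most a multiple of \<open>p\<^sup>-\<^sup>t\<close> with \<open>p\<^sup>2 = q\<close>. The velocity along
  the orbit of such an \<open>x\<close> is summable, and the orbit converges to an equilibrium \<open>e\<close>. The slow expansion
  passes to \<open>e\<close>, so near \<open>e\<close> all vectors that stay outside \<open>C\<close> are contracted. Therefore the
  velocity is summable along the orbits of all points of \<open>U\<close> near \<open>x\<close>.
\<close>

section \<open>Quantitative form of strong positivity\<close>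

text \<open>The tolerance is relative to \<open>norm (T c)\<close>, so the condition is invariant
  under scaling of \<open>c\<close> and can be obtained by compactness from unit vectors. It
  measures how deep \<open>T\<close> pushes \<open>C\<close> into its interior.\<close>

definition cone_gap :: "'a::euclidean_space set \<Rightarrow> real \<Rightarrow> ('a \<Rightarrow>\<^sub>L 'a) \<Rightarrow> bool" where
  "cone_gap C \<epsilon> T \<longleftrightarrow>
     (\<forall>c\<in>C. c \<noteq> 0 \<longrightarrow> (\<forall>z. norm (z - T c) \<le> \<epsilon> * norm (T c) \<longrightarrow> z \<in> interior C))"

lemma interior_scaleR_mem:
  fixes C :: "'a::euclidean_space set"
  assumes sc: "\<forall>v\<in>C. \<forall>l. l *\<^sub>R v \<in> C" and x: "x \<in> interior C" and l: "l \<noteq> 0"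
  shows "l *\<^sub>R x \<in> interior C"
proof -
  have "(\<lambda>v. l *\<^sub>R v) ` C = C"
  proof
    show "(\<lambda>v. l *\<^sub>R v) ` C \<subseteq> C" using sc by auto
    show "C \<subseteq> (\<lambda>v. l *\<^sub>R v) ` C"
    proof
      fix v assume "v \<in> C"
      then have "(1/l) *\<^sub>R v \<in> C" using sc by blast
      moreover have "v = l *\<^sub>R ((1/l) *\<^sub>R v)" using l by simp
      ultimately show "v \<in> (\<lambda>v. l *\<^sub>R v) ` C" by blast
    qed
  qed
  moreover have "interior ((\<lambda>v. l *\<^sub>R v) ` C) = (\<lambda>v. l *\<^sub>R v) ` interior C"
    using l by (intro interior_injective_linear_image) (auto simp: inj_on_def linear_iff scaleR_add_right)
  ultimately show ?thesis using x by (metis imageI)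
qed

text \<open>\<open>\<rho>\<close> is the half-length, in units of \<open>u\<close>, of a segment in
  \<open>C\<close> centred at \<open>v\<close>. Its ends are vectors of \<open>C\<close>, so the gap
  yields balls inside \<open>C\<close> about their images. Because \<open>T u\<close> avoids the
  interior, these images cannot be short compared with \<open>\<rho> * norm (T u)\<close>, and the
  balls prolong the image segment by a fixed factor. The norm bound has the same source: if
  \<open>T v\<close> were too short, \<open>T u\<close> would lie in the gap around a multiple of
  the image of an end.\<close>

lemma gap_growth:
  fixes v u :: "'a::euclidean_space" and T :: "'a \<Rightarrow>\<^sub>L 'a"
  assumes sc: "\<forall>v\<in>C. \<forall>l. l *\<^sub>R v \<in> C"
    and cgap: "cone_gap C \<epsilon> T"
    and e: "0 < \<epsilon>" "\<epsilon> \<le> 1"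
    and v: "v \<in> C" "v \<noteq> 0"
    and tube: "\<forall>s. \<bar>s\<bar> \<le> \<rho> \<longrightarrow> v + s *\<^sub>R u \<in> C" and rho: "0 < \<rho>"
    and out: "T u \<notin> interior C"
  shows "\<bar>s\<bar> \<le> \<rho> * (1 + \<epsilon>\<^sup>2/2) \<Longrightarrow> T v + s *\<^sub>R T u \<in> C"
    and "norm (T u) \<le> 2 / (\<epsilon>\<^sup>2 * \<rho>) * norm (T v)"
proof -
  have gap: "z \<in> interior C" if "c \<in> C" "c \<noteq> 0" "norm (z - T c) \<le> \<epsilon> * norm (T c)" for c z
    using cgap that by (auto simp: cone_gap_def)
  \<comment> \<open>Only \<open>\<sigma> = 1\<close> and \<open>\<sigma> = -1\<close> matter: they
    give the two ends of the image segment.\<close>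
  define p where "p \<sigma> = T v + (\<sigma> * \<rho>) *\<^sub>R T u" for \<sigma>
  have TC: "T c \<in> C" if "c \<in> C" for c
  proof (cases "c = 0")
    case True then show ?thesis using sc that by (force simp: blinfun.zero_right)
  next
    case False
    then have "T c \<in> interior C" using gap[OF that False, of "T c"] e by simp
    then show ?thesis using interior_subset by blast
  qed
  have pT: "p \<sigma> = T (v + (\<sigma> * \<rho>) *\<^sub>R u)" for \<sigma>
    by (simp add: p_def blinfun.add_right blinfun.scaleR_right)
  have p1: "norm (p \<sigma>) > \<epsilon> * norm (T v)" if "\<bar>\<sigma>\<bar> = 1" for \<sigma>
  proof (rule ccontr)
    assume "\<not> ?thesis"
    then have le: "norm (p \<sigma>) \<le> \<epsilon> * norm (T v)" by simp
    \<comment> \<open>This multiple of \<open>v\<close> is chosen so that \<open>T u - T c\<close>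
      is a multiple of \<open>p \<sigma>\<close>; a short \<open>p \<sigma>\<close> would place
      \<open>T u\<close> in the gap ball around \<open>T c\<close>.\<close>
    define c where "c = (-\<sigma>/\<rho>) *\<^sub>R v"
    have s2: "\<sigma> * \<sigma> = 1" using that by (metis abs_mult_self_eq mult_1)
    have cC: "c \<in> C" "c \<noteq> 0" unfolding c_def using bspec[OF sc v(1), THEN spec, of "-\<sigma>/\<rho>"] v rho that by auto
    have Tc: "T c = (-\<sigma>/\<rho>) *\<^sub>R T v" by (simp add: c_def blinfun.scaleR_right blinfun.minus_right)
    have "T u - T c = (\<sigma>/\<rho>) *\<^sub>R p \<sigma>"
      unfolding Tc p_def using rho s2 by (simp add: scaleR_add_right)
    then have "norm (T u - T c) = norm (p \<sigma>) / \<rho>" using that rho by simp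
    also have "\<dots> \<le> \<epsilon> * norm (T v) / \<rho>" using le rho by (simp add: divide_right_mono)
    also have "\<dots> = \<epsilon> * norm (T c)" using that rho by (simp add: Tc)
    finally show False using gap[OF cC] out by blast
  qed
  \<comment> \<open>The triangle inequality bounds \<open>\<rho> * norm (T u)\<close> by the norms
    of \<open>p \<sigma>\<close> and \<open>T v\<close>; after multiplication by
    \<open>\<epsilon> \<le> 1\<close> each of the two terms is at most
    \<open>norm (p \<sigma>)\<close>.\<close>
  have p2: "norm (p \<sigma>) \<ge> \<epsilon> / 2 * \<rho> * norm (T u)" if "\<bar>\<sigma>\<bar> = 1" for \<sigma>
  proof -
    have "(\<sigma> * \<rho>) *\<^sub>R T u = p \<sigma> - T v" by (simp add: p_def)
    then have "norm ((\<sigma> * \<rho>) *\<^sub>R T u) \<le> norm (p \<sigma>) + norm (T v)" by (metis norm_triangle_ineq4)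
    then have "\<rho> * norm (T u) \<le> norm (p \<sigma>) + norm (T v)" using that rho by (simp add: abs_mult)
    then have "\<epsilon> * (\<rho> * norm (T u)) \<le> \<epsilon> * norm (p \<sigma>) + \<epsilon> * norm (T v)"
      using e by (metis distrib_left mult_left_mono less_imp_le)
    moreover have "\<epsilon> * norm (p \<sigma>) \<le> norm (p \<sigma>)" using e by (simp add: mult_left_le_one_le)
    ultimately show ?thesis using p1[OF that] by (simp add: mult.assoc)
  qed
  have cnz: "v + (\<sigma> * \<rho>) *\<^sub>R u \<noteq> 0" if "\<bar>\<sigma>\<bar> = 1" for \<sigma>
  proof
    assume "v + (\<sigma> * \<rho>) *\<^sub>R u = 0"
    then have "p \<sigma> = 0" by (simp add: pT blinfun.zero_right)
    moreover have "0 \<le> \<epsilon> * norm (T v)" using e by simp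
    ultimately show False using p1[OF that] by simp
  qed
  have cC: "v + (\<sigma> * \<rho>) *\<^sub>R u \<in> C" if "\<bar>\<sigma>\<bar> = 1" for \<sigma>
    using tube[THEN spec, of "\<sigma> * \<rho>"] that rho by (simp add: abs_mult)
  show "T v + s *\<^sub>R T u \<in> C" if s: "\<bar>s\<bar> \<le> \<rho> * (1 + \<epsilon>\<^sup>2/2)"
  proof (cases "\<bar>s\<bar> \<le> \<rho>")
    case True
    then show ?thesis using TC[OF mp[OF spec[OF tube] True]] by (simp add: blinfun.add_right blinfun.scaleR_right)
  next
    case False
    define \<sigma> where "\<sigma> = sgn s"
    have sg: "\<bar>\<sigma>\<bar> = 1" using False rho by (simp add: \<sigma>_def abs_sgn_eq)
    \<comment> \<open>\<open>d\<close> is the overshoot beyond the nearer end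
      \<open>p \<sigma>\<close>. By \<open>p2\<close> it stays within the gap ball around that
      end.\<close>
    define d where "d = \<bar>s\<bar> - \<rho>"
    have d: "0 \<le> d" "d \<le> \<rho> * \<epsilon>\<^sup>2/2" using False s by (auto simp: d_def algebra_simps)
    have seq: "s = \<sigma> * \<rho> + \<sigma> * d" by (simp add: \<sigma>_def d_def algebra_simps abs_mult_sgn)
    have "T v + s *\<^sub>R T u - p \<sigma> = (\<sigma> * d) *\<^sub>R T u"
      by (simp add: p_def seq scaleR_add_left)
    then have "norm (T v + s *\<^sub>R T u - p \<sigma>) = d * norm (T u)" using sg d by (simp add: abs_mult)
    also have "\<dots> \<le> \<rho> * \<epsilon>\<^sup>2/2 * norm (T u)" using d by (intro mult_right_mono) auto
    also have "\<dots> = \<epsilon> * (\<epsilon> / 2 * \<rho> * norm (T u))" by (simp add: power2_eq_square)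
    also have "\<dots> \<le> \<epsilon> * norm (p \<sigma>)" using p2[OF sg] e by (intro mult_left_mono) auto
    finally have "T v + s *\<^sub>R T u \<in> interior C" using gap[OF cC[OF sg] cnz[OF sg]] pT by simp
    then show ?thesis using interior_subset by blast
  qed
  show "norm (T u) \<le> 2 / (\<epsilon>\<^sup>2 * \<rho>) * norm (T v)"
  proof (rule ccontr)
    assume "\<not> ?thesis"
    then have "norm (T v) < \<epsilon>\<^sup>2 * \<rho> / 2 * norm (T u)" using e rho by (simp add: field_simps)
    also have "\<dots> = \<epsilon> * (\<epsilon> / 2 * \<rho> * norm (T u))" by (simp add: power2_eq_square)
    also have "\<dots> \<le> \<epsilon> * norm (p 1)" using p2[of 1] e by (intro mult_left_mono) auto
    finally have lt: "norm (T v) \<le> \<epsilon> * norm (p 1)" by simp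
    \<comment> \<open>Now the end at \<open>\<sigma> = 1\<close>, divided by \<open>\<rho>\<close>,
      plays the part of the cone vector, and \<open>T u - T c\<close> is a multiple of
      \<open>T v\<close>.\<close>
    define c where "c = (1/\<rho>) *\<^sub>R (v + (1 * \<rho>) *\<^sub>R u)"
    have c: "c \<in> C" "c \<noteq> 0" unfolding c_def using cC[of 1] cnz[of 1] rho sc by auto
    have Tc: "T c = (1/\<rho>) *\<^sub>R p 1" unfolding c_def pT by (simp only: blinfun.scaleR_right)
    have "T u - T c = - (1/\<rho>) *\<^sub>R T v"
      unfolding Tc p_def using rho by (simp add: scaleR_add_right)
    then have "norm (T u - T c) = norm (T v) / \<rho>" using rho by simp
    also have "\<dots> \<le> \<epsilon> * norm (T c)" using lt rho by (simp add: Tc divide_right_mono)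
    finally show False using gap[OF c] out by blast
  qed
qed

text \<open>The normalised images \<open>T v / norm (T v)\<close> of unit vectors of
  \<open>C\<close> form a compact subset of the interior, hence keep a uniform distance from its
  complement; homogeneity carries this over to all of \<open>C\<close>.\<close>

lemma compact_positive_gap:
  fixes C :: "'a::euclidean_space set" and \<T> :: "('a \<Rightarrow>\<^sub>L 'a) set"
  assumes "compact \<T>" "closed C" and sc: "\<forall>v\<in>C. \<forall>l. l *\<^sub>R v \<in> C"
    and pos: "\<And>T v. T \<in> \<T> \<Longrightarrow> v \<in> C \<Longrightarrow> v \<noteq> 0 \<Longrightarrow> T v \<in> interior C \<and> T v \<noteq> 0"
  obtains \<epsilon> where "0 < \<epsilon>" "\<epsilon> \<le> 1"
    "\<And>T. T \<in> \<T> \<Longrightarrow> cone_gap C \<epsilon> T"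
proof -
  define K where "K = \<T> \<times> (C \<inter> sphere 0 1)"
  define g :: "('a \<Rightarrow>\<^sub>L 'a) \<times> 'a \<Rightarrow> 'a"
    where "g = (\<lambda>(T, v). (1 / norm (blinfun_apply T v)) *\<^sub>R blinfun_apply T v)"
  have K: "compact K" unfolding K_def using assms(1,2)
    by (intro compact_Times closed_Int_compact) auto
  have nz: "blinfun_apply T v \<noteq> 0" if "(T,v) \<in> K" for T v
    using that pos[of T v] norm_zero by (force simp: K_def)
  have "continuous_on K g" unfolding g_def case_prod_beta
    by (intro continuous_intros) (use nz in force)
  then have cg: "compact (g ` K)" using K by (rule compact_continuous_image)
  have "g ` K \<subseteq> interior C"
  proof
    fix y assume "y \<in> g ` K"
    then obtain T v where Tv: "(T,v) \<in> K" "y = g (T,v)" by auto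
    then have "T v \<in> interior C" using pos[of T v] norm_zero by (force simp: K_def)
    then show "y \<in> interior C" unfolding Tv(2) g_def prod.case
      by (intro interior_scaleR_mem sc) (use nz[OF Tv(1)] in auto)
  qed
  then obtain \<delta> where d: "\<delta> > 0" "(\<Union>x\<in>g ` K. ball x \<delta>) \<subseteq> interior C"
    using compact_subset_open_imp_ball_epsilon_subset[OF cg open_interior] by metis
  \<comment> \<open>Halving \<open>\<delta>\<close> makes the final estimate strict, as the open
    balls require.\<close>
  define \<epsilon> where "\<epsilon> = min 1 (\<delta>/2)"
  show thesis
  proof
    show "0 < \<epsilon>" "\<epsilon> \<le> 1" using d by (auto simp: \<epsilon>_def)
    fix T assume T: "T \<in> \<T>"
    have "z \<in> interior C"
      if c: "c \<in> C" "c \<noteq> 0" and z: "norm (z - blinfun_apply T c) \<le> \<epsilon> * norm (T c)" for c z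
    proof -
    define v where "v = (1 / norm c) *\<^sub>R c"
    have v: "(T, v) \<in> K" using T c sc by (auto simp: K_def v_def)
    have nTc: "norm (T c) > 0" using pos[OF T c] by simp
    have gv: "g (T, v) = (1 / norm (T c)) *\<^sub>R T c"
      using c by (simp add: g_def v_def blinfun.scaleR_right)
    have "dist (g (T,v)) ((1 / norm (T c)) *\<^sub>R z) = norm ((1 / norm (T c)) *\<^sub>R (z - T c))"
      unfolding gv dist_norm by (metis norm_minus_commute scaleR_diff_right)
    also have "\<dots> = norm (z - T c) / norm (T c)" by simp
    also have "\<dots> \<le> \<epsilon>" using z nTc by (simp add: field_simps)
    also have "\<dots> < \<delta>" using d by (simp add: \<epsilon>_def)
    finally have "(1 / norm (T c)) *\<^sub>R z \<in> interior C" using d(2) v by (force simp: mem_ball)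
    then have "norm (T c) *\<^sub>R ((1 / norm (T c)) *\<^sub>R z) \<in> interior C"
      by (rule interior_scaleR_mem[OF sc]) (use nTc in auto)
    then show "z \<in> interior C" using nTc by simp
    qed
    then show "cone_gap C \<epsilon> T" by (auto simp: cone_gap_def)
  qed
qed

subsection \<open>Exponential separation\<close>

text \<open>\<open>X\<close> is the compact positively invariant set on which all constants are
  uniform; in the theorem it is the closure of the orbit set. Time is two-sided, so
  \<open>\<Phi> t\<close> and \<open>D t x\<close> are invertible even though \<open>X\<close> is
  invariant only forwards.\<close>

locale cone_flow =
  fixes \<Phi> :: "real \<Rightarrow> 'a::euclidean_space \<Rightarrow> 'a"
    and D :: "real \<Rightarrow> 'a \<Rightarrow> ('a \<Rightarrow>\<^sub>L 'a)"
    and C X :: "'a set"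
  assumes flow_0: "\<Phi> 0 x = x"
    and flow_add: "\<Phi> (s + t) x = \<Phi> s (\<Phi> t x)"
    and flow_continuous: "continuous_on UNIV (\<lambda>(t, x). \<Phi> t x)"
    and flow_derivative: "(\<Phi> t has_derivative blinfun_apply (D t x)) (at x)"
    and D_continuous: "continuous_on UNIV (\<lambda>(t, x). D t x)"
    and cone_closed: "closed C"
    and cone_scale: "v \<in> C \<Longrightarrow> l *\<^sub>R v \<in> C"
    and flow_cone: "x - y \<in> C \<Longrightarrow> 0 \<le> t \<Longrightarrow> \<Phi> t x - \<Phi> t y \<in> C"
    and flow_strict: "x \<noteq> y \<Longrightarrow> x - y \<in> C \<Longrightarrow> 0 < t \<Longrightarrow> \<Phi> t x - \<Phi> t y \<in> interior C"
    and D_strict: "0 < t \<Longrightarrow> v \<in> C \<Longrightarrow> v \<noteq> 0 \<Longrightarrow> D t x v \<in> interior C"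
    and X_compact: "compact X"
    and X_invariant: "x \<in> X \<Longrightarrow> 0 \<le> t \<Longrightarrow> \<Phi> t x \<in> X"
begin

lemma cone_scale': "\<forall>v\<in>C. \<forall>l. l *\<^sub>R v \<in> C"
  using cone_scale by blast

lemma flow_minus: "\<Phi> (-t) (\<Phi> t x) = x"
  using flow_add[of "-t" t x] by (simp add: flow_0)

lemma flow_inj: "\<Phi> t x = \<Phi> t y \<longleftrightarrow> x = y"
  by (metis flow_minus)

lemma D_0: "D 0 x v = v"
proof -
  have "(\<Phi> 0 has_derivative (\<lambda>v. v)) (at x)"
    by (rule has_derivative_eq_rhs[OF has_derivative_transform_eventually[OF has_derivative_ident]])
      (auto simp: flow_0)
  then have "blinfun_apply (D 0 x) = (\<lambda>v. v)" by (rule has_derivative_unique[OF flow_derivative])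
  then show ?thesis by simp
qed

lemma D_add: "D (s + t) x v = D s (\<Phi> t x) (D t x v)"
proof -
  have "(\<Phi> (s + t) has_derivative (\<lambda>v. D s (\<Phi> t x) (D t x v))) (at x)"
  proof -
    have "\<Phi> (s + t) = (\<lambda>y. \<Phi> s (\<Phi> t y))" by (rule ext) (rule flow_add)
    then show ?thesis
      using has_derivative_compose[OF flow_derivative[of t x] flow_derivative[of s "\<Phi> t x"]] by simp
  qed
  then have "blinfun_apply (D (s + t) x) = (\<lambda>v. D s (\<Phi> t x) (D t x v))"
    by (rule has_derivative_unique[OF flow_derivative])
  then show ?thesis by simp
qed

lemma D_inj: "D t x v = 0 \<longleftrightarrow> v = 0"
proof
  assume "D t x v = 0"
  then have "D (-t + t) x v = 0" unfolding D_add by (simp add: blinfun.zero_right)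
  then show "v = 0" by (simp add: D_0)
qed (simp add: blinfun.zero_right)

lemma D_cone: "v \<in> C \<Longrightarrow> 0 \<le> t \<Longrightarrow> D t x v \<in> C"
  using D_strict[of t v x] interior_subset[of C]
  by (cases "v = 0"; cases "t = 0") (auto simp: D_0 blinfun.zero_right)

lemma continuous_flow_comp:
  "continuous_on S a \<Longrightarrow> continuous_on S b \<Longrightarrow> continuous_on S (\<lambda>z. \<Phi> (a z) (b z))"
  using continuous_on_compose2[OF flow_continuous, of S "\<lambda>z. (a z, b z)"]
  by (simp add: continuous_on_Pair)

lemma continuous_D_comp:
  "continuous_on S a \<Longrightarrow> continuous_on S b \<Longrightarrow> continuous_on S (\<lambda>z. D (a z) (b z))"
  using continuous_on_compose2[OF D_continuous, of S "\<lambda>z. (a z, b z)"]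
  by (simp add: continuous_on_Pair)

lemma D_bounded:
  obtains B where "1 \<le> B" "\<And>s x. 0 \<le> s \<Longrightarrow> s \<le> r \<Longrightarrow> x \<in> X \<Longrightarrow> norm (D s x) \<le> B"
proof -
  have "compact ((\<lambda>(s,x). D s x) ` ({0..r} \<times> X))"
    by (intro compact_continuous_image continuous_on_subset[OF D_continuous] compact_Times X_compact) auto
  then obtain B where "\<And>T. T \<in> (\<lambda>(s,x). D s x) ` ({0..r} \<times> X) \<Longrightarrow> norm T \<le> B"
    using compact_imp_bounded bounded_iff by metis
  then show thesis by (intro that[of "max 1 B"]) (force intro: max.coboundedI2)+
qed

lemma D_expand_lower:
  assumes "0 \<le> r"
  obtains a where "0 < a" "\<And>x v. x \<in> X \<Longrightarrow> a * norm v \<le> norm (D r x v)"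
proof -
  \<comment> \<open>The inverse of \<open>D r x\<close> is \<open>D (-r)\<close> at the image point,
    so a bound for these inverses gives a lower bound for \<open>D r x\<close>.\<close>
  have "compact ((\<lambda>x. D (-r) (\<Phi> r x)) ` X)"
    by (intro compact_continuous_image continuous_D_comp continuous_flow_comp continuous_intros X_compact)
  then obtain B where B: "\<And>x. x \<in> X \<Longrightarrow> norm (D (-r) (\<Phi> r x)) \<le> B"
    by (metis compact_imp_bounded bounded_iff imageI)
  show thesis
  proof (rule that[of "1 / max 1 B"])
    fix x v assume x: "x \<in> X"
    have "v = D (-r) (\<Phi> r x) (D r x v)" using D_add[of "-r" r x v] by (simp add: D_0)
    then have "norm v \<le> norm (D (-r) (\<Phi> r x)) * norm (D r x v)" by (metis norm_blinfun)
    also have "\<dots> \<le> max 1 B * norm (D r x v)" using B[OF x] by (intro mult_right_mono) auto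
    finally show "1 / max 1 B * norm v \<le> norm (D r x v)" by (simp add: field_simps)
  qed auto
qed

text \<open>If \<open>v + s u \<in> C\<close> for all \<open>\<bar>s\<bar> \<le> \<rho>\<close>, then one application of the derivative enlarges the
  admissible \<open>\<rho>\<close> by a factor that is bounded away from 1, as long as the image of \<open>u\<close> stays outside
  the interior of \<open>C\<close>.\<close>

lemma exponential_separation:
  obtains M q where "0 < M" "0 < q" "q < 1"
    "\<And>x n u v. x \<in> X \<Longrightarrow> v \<in> C \<Longrightarrow> D (real n) x u \<notin> interior C \<Longrightarrow>
       norm (D (real n) x u) * norm v \<le> M * q ^ n * norm (D (real n) x v) * norm u"
proof -
  obtain b where b: "1 \<le> b" "\<And>s x. 0 \<le> s \<Longrightarrow> s \<le> 1 \<Longrightarrow> x \<in> X \<Longrightarrow> norm (D s x) \<le> b"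
    using D_bounded[of 1] by metis
  obtain a where a: "0 < a" "\<And>x v. x \<in> X \<Longrightarrow> a * norm v \<le> norm (D 1 x v)"
    using D_expand_lower[of 1] by auto
  have cT: "compact (D 1 ` X)"
    by (intro compact_continuous_image continuous_D_comp continuous_intros X_compact)
  obtain \<epsilon> where e: "0 < \<epsilon>" "\<epsilon> \<le> 1" and
    gap: "\<And>T. T \<in> D 1 ` X \<Longrightarrow> cone_gap C \<epsilon> T"
    by (rule compact_positive_gap[OF cT cone_closed cone_scale']) (auto simp: D_inj D_strict)
  define \<theta> where "\<theta> = 1 + \<epsilon>\<^sup>2/2"
  have th: "\<theta> > 1" using e by (simp add: \<theta>_def)
  define K where "K = 2 * b / (\<epsilon> ^ 3 * a)"
  \<comment> \<open>The three entries serve \<open>n = 0\<close>, \<open>n = 1\<close> and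
    \<open>n \<ge> 2\<close>.\<close>
  define M where "M = max 1 (max (b / a * \<theta>) (K * \<theta>\<^sup>2))"
  define q where "q = 1 / \<theta>"
  have K: "K > 0" using b a e by (simp add: K_def)
  show thesis
  proof (rule that[of M q])
    show "0 < M" "0 < q" "q < 1" using th by (auto simp: M_def q_def)
    fix x n u v assume x: "x \<in> X" and v: "v \<in> C" and out: "D (real n) x u \<notin> interior C"
    let ?u = "\<lambda>j. D (real j) x u" and ?v = "\<lambda>j. D (real j) x v" and ?T = "\<lambda>j. D 1 (\<Phi> (real j) x)"
    have uS: "D (real (Suc j)) x w = ?T j (D (real j) x w)" for j w
      using D_add[of 1 "real j" x w] by simp
    have TX: "?T j \<in> D 1 ` X" for j using X_invariant[OF x] by auto
    show "norm (?u n) * norm v \<le> M * q ^ n * norm (?v n) * norm u"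
    proof (cases "u = 0 \<or> v = 0")
      case True then show ?thesis by (auto simp: blinfun.zero_right)
    next
      case False
      then have u0: "u \<noteq> 0" and v0: "v \<noteq> 0" by auto
      have vC: "?v j \<in> C" "?v j \<noteq> 0" for j using D_cone[OF v] v0 by (auto simp: D_inj)
      have unz: "?u j \<noteq> 0" for j using u0 by (simp add: D_inj)
      \<comment> \<open>The interior of \<open>C\<close> cannot be left by a nonzero vector, so
        being outside at time \<open>n\<close> forces being outside at all earlier times.\<close>
      have outj: "?u j \<notin> interior C" if "j \<le> n" for j
      proof
        assume i: "?u j \<in> interior C"
        then have "?u j \<in> C" using interior_subset by blast
        moreover have "j = n \<or> 0 < real (n - j)" using that by auto
        ultimately have "j = n \<or> D (real (n - j)) (\<Phi> (real j) x) (?u j) \<in> interior C"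
          using D_strict unz by blast
        moreover have "?u n = D (real (n - j)) (\<Phi> (real j) x) (?u j)"
          using D_add[of "real (n-j)" "real j" x u] that by (simp add: of_nat_diff)
        ultimately show False using out i by auto
      qed
      have u1: "norm (?u 1) \<le> b * norm u"
        using norm_blinfun[of "D 1 x" u] mult_right_mono[OF b(2)[of 1 x] norm_ge_zero[of u]] x by force
      have v1: "a * norm v \<le> norm (?v 1)" using a(2)[OF x] by simp
      have p_step: "K * \<theta>\<^sup>2 \<le> M" "b / a * \<theta> \<le> M" "1 \<le> M" by (auto simp: M_def)
      \<comment> \<open>The segment is available from time 1 on and the last step is spent on the
        norm bound, so \<open>n = Suc (Suc m)\<close> leaves \<open>m\<close> steps of growth. The
        two missing factors of \<open>\<theta>\<close> are absorbed in \<open>M\<close>.\<close>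
      consider "n = 0" | "n = 1" | m where "n = Suc (Suc m)" by (metis One_nat_def not0_implies_Suc)
      then show ?thesis
      proof cases
        case 1
        then show ?thesis using mult_right_mono[OF p_step(3), of "norm v * norm u"] by (simp add: D_0 mult_ac)
      next
        case 2
        have "norm (?u 1) * norm v \<le> b * norm u * (norm (?v 1) / a)"
          by (intro mult_mono u1) (use v1 a(1) b in \<open>auto simp: field_simps\<close>)
        also have "\<dots> = b / a * (norm (?v 1) * norm u)" by simp
        also have "\<dots> \<le> M * q * (norm (?v 1) * norm u)"
          using p_step(2) th by (intro mult_right_mono) (auto simp: q_def field_simps)
        finally show ?thesis using 2 by (simp add: mult_ac)
      next
        case (3 m)
        \<comment> \<open>For \<open>\<bar>s\<bar> \<le> \<rho>\<close> the perturbation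
          \<open>s *\<^sub>R D 1 x u\<close> has norm at most
          \<open>\<epsilon> * a * norm v\<close>, which is within the gap around
          \<open>D 1 x v\<close>.\<close>
        define \<rho> where "\<rho> = \<epsilon> * a * norm v / (b * norm u)"
        have rho: "\<rho> > 0" using e a b v0 u0 by (simp add: \<rho>_def)
        have tube: "\<bar>s\<bar> \<le> \<rho> * \<theta> ^ j \<Longrightarrow> ?v (Suc j) + s *\<^sub>R ?u (Suc j) \<in> C" if "Suc j \<le> n" for j s
          using that
        proof (induction j arbitrary: s)
          case 0
          have "\<bar>s\<bar> * norm (?u 1) \<le> \<rho> * (b * norm u)" using 0 u1 rho by (intro mult_mono) auto
          also have "\<dots> = \<epsilon> * (a * norm v)" using b u0 by (simp add: \<rho>_def)
          also have "\<dots> \<le> \<epsilon> * norm (?v 1)" using v1 e by (intro mult_left_mono) auto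
          finally have "norm ((?v 1 + s *\<^sub>R ?u 1) - ?T 0 v) \<le> \<epsilon> * norm (?T 0 v)"
            by (simp add: flow_0)
          then have "?v 1 + s *\<^sub>R ?u 1 \<in> interior C" using gap[OF TX] v v0 unfolding cone_gap_def by blast
          then show ?case using interior_subset by (auto)
        next
          case (Suc j)
          have rj: "\<rho> * \<theta> ^ j > 0" using rho th by simp
          have o: "?T (Suc j) (?u (Suc j)) \<notin> interior C" using outj[OF Suc.prems(2)] unfolding uS[of "Suc j"] .
          show ?case unfolding uS[of "Suc j"]
            by (rule gap_growth(1)[OF cone_scale' gap[OF TX] e vC _ rj o])
              (use Suc in \<open>auto simp: \<theta>_def mult_ac\<close>)
        qed
        have rj: "\<rho> * \<theta> ^ m > 0" using rho th by simp
        have o: "?T (Suc m) (?u (Suc m)) \<notin> interior C" using outj[of n] unfolding 3 uS[of "Suc m"] by simp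
        have "norm (?u n) \<le> 2 / (\<epsilon>\<^sup>2 * (\<rho> * \<theta> ^ m)) * norm (?v n)"
          unfolding 3 uS[of "Suc m"]
          by (rule gap_growth(2)[OF cone_scale' gap[OF TX] e vC _ rj o]) (use tube[of m] 3 in auto)
        also have "2 / (\<epsilon>\<^sup>2 * (\<rho> * \<theta> ^ m)) = K * q ^ m * norm u / norm v"
          using e a b u0 v0 th by (simp add: \<rho>_def K_def q_def field_simps power_divide power2_eq_square power3_eq_cube)
        finally have "norm (?u n) * norm v \<le> K * q ^ m * norm u * norm (?v n)"
          using v0 by (simp add: field_simps)
        also have "\<dots> = (K * \<theta>\<^sup>2) * (q ^ n * norm u * norm (?v n))"
          using th unfolding 3 by (simp add: q_def field_simps power2_eq_square)
        also have "\<dots> \<le> M * (q ^ n * norm u * norm (?v n))"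
          using th by (intro mult_right_mono p_step) (auto simp: q_def)
        finally show ?thesis by (simp add: mult_ac)
      qed
    qed
  qed
qed

end

subsection \<open>A complement of the cone\<close>

text \<open>\<open>P\<close> is a subspace of maximal dimension on which the quadratic form
  \<open>\<bar>T u\<bar>\<^sup>2 - \<sigma>\<^sup>2 \<bar>u\<bar>\<^sup>2\<close> is positive definite, and \<open>N\<close> is its orthogonal complement
  with respect to that form.\<close>

lemma expansion_splitting:
  fixes T :: "'a::euclidean_space \<Rightarrow> 'a"
  assumes T: "linear T" and sg: "0 \<le> \<sigma>"
  obtains P N where "subspace P" "subspace N" "DIM('a) \<le> dim P + dim N"
    "\<And>u. u \<in> P \<Longrightarrow> u \<noteq> 0 \<Longrightarrow> \<sigma> * norm u < norm (T u)"
    "\<And>u. u \<in> N \<Longrightarrow> norm (T u) \<le> \<sigma> * norm u"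
proof -
  interpret linear T by fact
  define B where "B u v = T u \<bullet> T v - \<sigma>\<^sup>2 * (u \<bullet> v)" for u v
  have Badd: "B (u + v) w = B u w + B v w" "B w (u + v) = B w u + B w v" for u v w
    by (simp_all add: B_def add inner_add algebra_simps)
  have Bscale: "B (a *\<^sub>R u) w = a * B u w" "B w (a *\<^sub>R u) = a * B w u" for a u w
    by (simp_all add: B_def scale algebra_simps)
  have Bsym: "B u v = B v u" for u v by (simp add: B_def inner_commute)
  have Bnorm: "B u u = (norm (T u))\<^sup>2 - (\<sigma> * norm u)\<^sup>2" for u
    by (simp add: B_def power2_norm_eq_inner power_mult_distrib)
  have Bpos: "0 < B u u \<longleftrightarrow> \<sigma> * norm u < norm (T u)" for u
    unfolding Bnorm using sg by (simp add: power_mono_iff linorder_not_le[symmetric])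
  define pos where "pos d \<longleftrightarrow> (\<exists>S. subspace S \<and> dim S = d \<and> (\<forall>u\<in>S. u \<noteq> 0 \<longrightarrow> 0 < B u u))" for d
  have p0: "pos 0" unfolding pos_def by (intro exI[of _ "{0}"]) auto
  have pb: "\<forall>d. pos d \<longrightarrow> d \<le> DIM('a)" unfolding pos_def using dim_subset_UNIV by blast
  obtain d where d: "pos d" "\<And>d'. pos d' \<Longrightarrow> d' \<le> d"
    using Nat.ex_has_greatest_nat[OF p0 pb] by blast
  obtain P where P: "subspace P" "dim P = d" "\<And>u. u \<in> P \<Longrightarrow> u \<noteq> 0 \<Longrightarrow> 0 < B u u"
    using d(1) unfolding pos_def by blast
  define S where "S p = adjoint T (T p) - \<sigma>\<^sup>2 *\<^sub>R p" for p
  have linS: "linear S"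
    using linear_add[OF adjoint_linear[OF T]] linear_scale[OF adjoint_linear[OF T]]
    by (intro linearI) (simp_all add: S_def add scale algebra_simps)
  have BS: "B u p = S p \<bullet> u" for u p
    using adjoint_works[OF T, of u "T p"] by (simp add: B_def S_def inner_diff inner_commute)
  define N where "N = {u \<in> UNIV. \<forall>y \<in> S ` P. orthogonal y u}"
  have N_iff: "u \<in> N \<longleftrightarrow> (\<forall>p\<in>P. B u p = 0)" for u
    by (auto simp: N_def orthogonal_def BS)
  have sN: "subspace N" 
  proof -
    have "B 0 p = 0" for p by (simp add: B_def zero)
    then show ?thesis unfolding subspace_def by (auto simp: N_iff Badd Bscale)
  qed
  have dN: "dim N + dim (S ` P) = DIM('a)"
    using dim_subspace_orthogonal_to_vectors[of "S ` P" UNIV] linear_subspace_image[OF linS P(1)]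
    by (simp add: N_def)
  have dS: "dim (S ` P) \<le> dim P" by (rule dim_image_le[OF linS])
  have Nle: "norm (T u) \<le> \<sigma> * norm u" if u: "u \<in> N" for u
  proof (rule ccontr)
    assume "\<not> ?thesis"
    \<comment> \<open>A vector of \<open>N\<close> on which the form is positive could be added to
      \<open>P\<close> without losing positive definiteness, against the maximality of
      \<open>d\<close>.\<close>
    then have Bu: "0 < B u u" using Bpos by auto
    have Bup: "B u p = 0" "B p u = 0" if "p \<in> P" for p using u that N_iff Bsym by auto
    have uP: "u \<notin> P" using Bup(1) Bu by force
    have "dim (span (insert u P)) = Suc d"
      using uP P(1,2) by (simp add: dim_insert span_eq_iff[THEN iffD2])
    moreover have "0 < B y y" if "y \<in> span (insert u P)" "y \<noteq> 0" for y
    proof -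
      obtain a where a: "y - a *\<^sub>R u \<in> P"
        using \<open>y \<in> span _\<close> P(1) by (auto simp: span_insert span_eq_iff[THEN iffD2])
      define p where "p = y - a *\<^sub>R u"
      have y: "y = p + a *\<^sub>R u" by (simp add: p_def)
      have p: "p \<in> P" using a p_def by simp
      have "B y y = B p p + a * a * B u u" unfolding y by (simp add: Badd Bscale Bup[OF p])
      moreover have "0 \<le> B p p" using P(3)[OF p] by (cases "p = 0") (auto simp: B_def zero)
      moreover have "0 \<le> a * a * B u u" using Bu by simp
      moreover have "0 < B p p \<or> 0 < a * a * B u u"
      proof (cases "p = 0")
        case True
        then have "a \<noteq> 0" using y \<open>y \<noteq> 0\<close> by auto
        then have "0 < a * a" by (auto simp: zero_less_mult_iff linorder_neq_iff)
        then show ?thesis using Bu by simp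
      qed (use P(3)[OF p] in auto)
      ultimately show ?thesis by linarith
    qed
    ultimately have "pos (Suc d)" unfolding pos_def by (intro exI[of _ "span (insert u P)"]) auto
    then show False using d(2)[of "Suc d"] by simp
  qed
  show thesis
    by (rule that[OF P(1) sN]) (use dN dS P(3) Bpos Nle in auto)
qed

context cone_flow
begin

text \<open>At a late time \<open>n\<close>, vectors of \<open>C\<close> are expanded at least by
  \<open>\<mu>\<close>, while vectors whose image is outside \<open>C\<close> are expanded at most
  by \<open>\<mu>/2\<close>. Splitting at the level \<open>\<mu>/2\<close> gives a space
  \<open>E\<close> that is mapped into \<open>C\<close>, hence of dimension at most
  \<open>dim W\<close>, and a space \<open>N\<close> that meets \<open>C\<close> only in 0. By
  dimension \<open>N\<close> is a complement of \<open>W\<close>, and \<open>P\<close> is the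
  projection onto \<open>W\<close> along \<open>N\<close>.\<close>

lemma cone_projection:
  assumes "x \<in> X" "subspace W" "W \<subseteq> C" "w0 \<in> W" "w0 \<noteq> 0"
    and kC: "\<And>S. subspace S \<Longrightarrow> S \<subseteq> C \<Longrightarrow> dim S \<le> dim W"
  obtains P where "linear P" "\<And>x. P x \<in> W" "\<And>w. w \<in> W \<Longrightarrow> P w = w"
    "\<And>v. v \<in> C \<Longrightarrow> P v = 0 \<Longrightarrow> v = 0"
proof -
  obtain M q where Mq: "0 < M" "0 < q" "q < 1" and
    sep: "\<And>x n u v. x \<in> X \<Longrightarrow> v \<in> C \<Longrightarrow> D (real n) x u \<notin> interior C \<Longrightarrow>
       norm (D (real n) x u) * norm v \<le> M * q ^ n * norm (D (real n) x v) * norm u"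
    using exponential_separation by metis
  obtain n where "q ^ n < 1 / (2 * M)"
    using real_arch_pow_inv[of "1 / (2*M)" q] Mq by auto
  then have n: "M * q ^ n < 1/2" using Mq by (simp add: field_simps)
  define T where "T = blinfun_apply (D (real n) x)"
  have linT: "linear T" unfolding T_def by (simp add: blinfun.bounded_linear_right bounded_linear.linear)
  define K where "K = C \<inter> sphere 0 1"
  have "compact K" unfolding K_def using cone_closed by (intro closed_Int_compact) auto
  moreover have "(1 / norm w0) *\<^sub>R w0 \<in> K" using assms cone_scale by (auto simp: K_def)
  moreover have "continuous_on K (\<lambda>v. norm (T v))" unfolding T_def by (intro continuous_intros)
  ultimately obtain v0 where v0: "v0 \<in> K" "\<And>v. v \<in> K \<Longrightarrow> norm (T v0) \<le> norm (T v)"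
    using continuous_attains_inf[of K "\<lambda>v. norm (T v)"] by blast
  \<comment> \<open>The weakest expansion of unit vectors of \<open>C\<close>, attained at
    \<open>v0\<close>.\<close>
  define \<mu> where "\<mu> = norm (T v0)"
  have v0': "v0 \<in> C" "norm v0 = 1" using v0 by (auto simp: K_def)
  have mu: "\<mu> > 0" using v0' D_inj[of "real n" x v0] norm_zero by (force simp: \<mu>_def T_def)
  have Cge: "\<mu> * norm v \<le> norm (T v)" if "v \<in> C" for v
  proof (cases "v = 0")
    case False
    then have "(1 / norm v) *\<^sub>R v \<in> K" using that cone_scale by (auto simp: K_def)
    then have "\<mu> \<le> norm (T ((1 / norm v) *\<^sub>R v))" unfolding \<mu>_def by (rule v0(2))
    also have "\<dots> = norm (T v) / norm v" by (simp add: T_def blinfun.scaleR_right)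
    finally show ?thesis using False by (simp add: field_simps)
  qed simp
  obtain E N where EN: "subspace E" "subspace N" "DIM('a) \<le> dim E + dim N"
    "\<And>u. u \<in> E \<Longrightarrow> u \<noteq> 0 \<Longrightarrow> \<mu>/2 * norm u < norm (T u)"
    "\<And>u. u \<in> N \<Longrightarrow> norm (T u) \<le> \<mu>/2 * norm u"
    using expansion_splitting[OF linT, of "\<mu>/2"] mu by (metis half_gt_zero less_imp_le)
  \<comment> \<open>Separation of \<open>u\<close> against the least expanded vector
    \<open>v0\<close> would give \<open>norm (T u) \<le> \<mu>/2 * norm u\<close>, contrary to the
    choice of \<open>E\<close>.\<close>
  have TE: "T ` E \<subseteq> C"
  proof (rule image_subsetI, rule ccontr)
    fix u assume u: "u \<in> E" "T u \<notin> C"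
    then have u0: "u \<noteq> 0" using cone_scale[OF v0'(1), of 0] linear_0[OF linT] by auto
    have "T u \<notin> interior C" using u interior_subset by blast
    then have "norm (T u) * norm v0 \<le> M * q ^ n * norm (T v0) * norm u"
      unfolding T_def by (intro sep assms v0')
    also have "\<dots> \<le> 1/2 * (\<mu> * norm u)"
      unfolding \<mu>_def[symmetric] mult.assoc[of _ \<mu>] using n mu by (intro mult_right_mono) auto
    finally show False using EN(4)[OF u(1) u0] v0' by simp
  qed
  have injE: "inj_on T E"
    unfolding T_def inj_on_def using D_inj[of "real n" x "_ - _"] by (metis blinfun.diff_right eq_iff_diff_eq_0)
  have dE: "dim E \<le> dim W"
    using kC[OF linear_subspace_image[OF linT EN(1)] TE] dim_image_eq[OF linT, of E] injE EN(1)
    by (simp add: span_eq_iff[THEN iffD2])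
  have NC: "v = 0" if "v \<in> N" "v \<in> C" for v
  proof (rule ccontr)
    assume "v \<noteq> 0"
    then have "\<mu>/2 * norm v < \<mu> * norm v" using mu by simp
    then show False using EN(5)[OF that(1)] Cge[OF that(2)] by linarith
  qed
  have WN: "W \<inter> N = {0}" using NC assms(3) subspace_0[OF assms(2)] subspace_0[OF EN(2)] by auto
  have "dim {x + y |x y. x \<in> W \<and> y \<in> N} + dim (W \<inter> N) = dim W + dim N"
    by (rule dim_sums_Int[OF assms(2) EN(2)])
  then have "DIM('a) \<le> dim {x + y |x y. x \<in> W \<and> y \<in> N}" using WN EN(3) dE by simp
  then have "dim {x + y |x y. x \<in> W \<and> y \<in> N} = DIM('a)" using dim_subset_UNIV le_antisym by blast
  then have "span {x + y |x y. x \<in> W \<and> y \<in> N} = UNIV" by (simp add: dim_eq_full)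
  then have sumU: "{x + y |x y. x \<in> W \<and> y \<in> N} = UNIV"
    using subspace_sums[OF assms(2) EN(2)] by (simp add: span_eq_iff[THEN iffD2])
  have ex: "\<exists>w. w \<in> W \<and> z - w \<in> N" for z
  proof -
    have "z \<in> {x + y |x y. x \<in> W \<and> y \<in> N}" by (simp add: sumU)
    then show ?thesis by auto
  qed
  define P where "P z = (SOME w. w \<in> W \<and> z - w \<in> N)" for z
  have P: "P z \<in> W" "z - P z \<in> N" for z using someI_ex[OF ex[of z]] by (auto simp: P_def)
  have uniq: "P z = w" if "w \<in> W" "z - w \<in> N" for z w
  proof -
    have "P z - w \<in> W" using P that assms(2) by (simp add: subspace_diff)
    moreover have "(z - w) - (z - P z) \<in> N" using P that EN(2) by (blast intro: subspace_diff)
    ultimately have "P z - w \<in> W \<inter> N" by (simp add: algebra_simps)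
    then show ?thesis using WN by simp
  qed
  show thesis
  proof (rule that[of P])
    show "linear P"
    proof (rule linearI)
      fix a b
      have "(a - P a) + (b - P b) \<in> N" using P EN(2) by (blast intro: subspace_add)
      then show "P (a + b) = P a + P b"
        by (intro uniq subspace_add assms(2) P) (simp add: algebra_simps)
    next
      fix r b
      have "r *\<^sub>R (b - P b) \<in> N" using P EN(2) by (blast intro: subspace_scale)
      then show "P (r *\<^sub>R b) = r *\<^sub>R P b"
        by (intro uniq subspace_scale assms(2) P) (simp add: algebra_simps)
    qed
    show "P w = w" if "w \<in> W" for w using that subspace_0[OF EN(2)] by (intro uniq) auto
    show "v = 0" if "v \<in> C" "P v = 0" for v using NC[of v] P(2)[of v] that by simp
  qed (rule P)
qed

end

subsection \<open>Determinants and volume\<close>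

text \<open>The change of variables theorem is only available for vectors whose index type is
  well-ordered; this copy of a finite type provides such an index type of the same size.\<close>

typedef 'a wo_copy = "UNIV :: 'a set" morphisms of_wo to_wo ..

definition wo_rank :: "'a::finite \<Rightarrow> nat" where
  "wo_rank = (SOME f. inj f)"

lemma inj_wo_rank: "inj wo_rank"
proof -
  have "\<exists>f :: 'a \<Rightarrow> nat. inj f" using finite_imp_inj_to_nat_seg[of "UNIV :: 'a set"] by auto
  then show ?thesis unfolding wo_rank_def by (rule someI_ex)
qed

instantiation wo_copy :: (finite) wellorder
begin

definition "x \<le> y \<longleftrightarrow> wo_rank (of_wo x) \<le> wo_rank (of_wo y)"
definition "x < y \<longleftrightarrow> wo_rank (of_wo x) < wo_rank (of_wo y)"

instance
proof (intro_classes, goal_cases)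
  case (1 x y) then show ?case unfolding less_eq_wo_copy_def less_wo_copy_def by auto
next
  case (2 x) show ?case unfolding less_eq_wo_copy_def by (rule order_refl)
next
  case (3 x y z) then show ?case unfolding less_eq_wo_copy_def by (rule order_trans)
next
  case (4 x y)
  then have "wo_rank (of_wo x) = wo_rank (of_wo y)" unfolding less_eq_wo_copy_def by (rule antisym)
  then show ?case by (simp only: inj_eq[OF inj_wo_rank] of_wo_inject)
next
  case (5 x y) show ?case unfolding less_eq_wo_copy_def by (rule linear)
next
  case (6 P a)
  show ?case
  proof (induction a rule: measure_induct_rule[where f = "\<lambda>x. wo_rank (of_wo x)"])
    case (less x)
    show ?case
    proof (rule 6)
      fix y assume "y < x"
      then show "P y" unfolding less_wo_copy_def by (rule less.IH)
    qed
  qed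
qed

end

lemma bij_of_wo: "bij of_wo"
proof (rule bijI)
  show "inj of_wo" by (rule injI) (simp add: of_wo_inject)
  show "surj of_wo" by (rule surjI[of of_wo to_wo]) (simp add: to_wo_inverse)
qed

instance wo_copy :: (finite) finite
proof
  have "bij (of_wo :: 'a wo_copy \<Rightarrow> 'a)" by (rule bij_of_wo)
  then show "finite (UNIV :: 'a wo_copy set)" using bij_betw_finite by fastforce
qed

lemma card_wo_copy: "CARD('a wo_copy) = CARD('a::finite)"
  using bij_of_wo by (rule bij_betw_same_card)

text \<open>The image of the unit ball contains the ball of radius \<open>\<mu>\<close>; comparing
  volumes gives the bound.\<close>

lemma det_ge_power:
  fixes A :: "real^'m::{finite,wellorder} \<Rightarrow> real^'m::_"
  assumes A: "linear A" and mu: "0 < \<mu>" and le: "\<And>x. \<mu> * norm x \<le> norm (A x)"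
  shows "\<mu> ^ CARD('m) \<le> \<bar>det (matrix A)\<bar>"
proof -
  have "inj A" unfolding linear_injective_0[OF A]
  proof safe
    fix x assume "A x = 0"
    then have "\<mu> * norm x \<le> 0" using le[of x] by simp
    then show "x = 0" using mu by (simp add: mult_le_0_iff)
  qed
  then have sA: "surj A" using linear_injective_imp_surjective[OF A] by simp
  have sub: "ball 0 \<mu> \<subseteq> A ` ball 0 1"
  proof
    fix y :: "(real,'m) vec" assume y: "y \<in> ball 0 \<mu>"
    obtain x where x: "y = A x" using sA by (metis surjD)
    have "\<mu> * norm x < \<mu> * 1" using le[of x] y by (simp add: x)
    then have "norm x < 1" using mu by simp
    then show "y \<in> A ` ball 0 1" using x by auto
  qed
  have "\<mu> ^ CARD('m) * measure lebesgue (ball (0::(real,'m) vec) 1) = measure lebesgue (ball (0::(real,'m) vec) \<mu>)"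
    using content_ball_conv_unit_ball[of \<mu> "0::(real,'m) vec"] mu by simp
  also have "\<dots> \<le> measure lebesgue (A ` ball 0 1)"
    by (intro measure_mono_fmeasurable sub measurable_linear_image A) auto
  also have "\<dots> = \<bar>det (matrix A)\<bar> * measure lebesgue (ball (0::(real,'m) vec) 1)"
    by (intro measure_linear_image A) auto
  finally show ?thesis by (simp add: content_ball_gt_0_iff)
qed

text \<open>In a basis made of bases of the range and the kernel of \<open>P\<close> the map is
  diagonal. \<open>k\<close> is the number of basis vectors in the range, positive because
  \<open>P w0\<close> is not 0.\<close>

lemma det_projection_scaling:
  fixes P :: "real^'m \<Rightarrow> real^'m"
  assumes P: "linear P" and PP: "\<And>x. P (P x) = P x" and w0: "P w0 \<noteq> 0"
  obtains k l where "1 \<le> k" "\<And>a b. det (matrix (\<lambda>x. a *\<^sub>R P x + b *\<^sub>R (x - P x))) = a ^ k * b ^ l"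
proof -
  interpret linear P by fact
  define S where "S a b x = a *\<^sub>R P x + b *\<^sub>R (x - P x)" for a b x
  have linS: "linear (S a b)" for a b
    unfolding S_def by (intro linearI) (simp_all add: add scale algebra_simps)
  have sW: "subspace (range P)" by (intro linear_subspace_image P) auto
  have sV: "subspace {x. P x = 0}" by (auto simp: subspace_def add scale)
  obtain BW where BW: "BW \<subseteq> range P" "independent BW" "range P \<subseteq> span BW" "card BW = dim (range P)"
    using basis_exists by metis
  obtain BV where BV: "BV \<subseteq> {x. P x = 0}" "independent BV" "{x. P x = 0} \<subseteq> span BV" "card BV = dim {x. P x = 0}"
    using basis_exists by metis
  have PW: "P x = x" if "x \<in> BW" for x using that BW(1) PP by auto
  have PV: "P x = 0" if "x \<in> BV" for x using that BV(1) by auto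
  have fin: "finite BW" "finite BV" using BW BV independent_imp_finite by auto
  have nz: "0 \<notin> BW" using BW(2) dependent_zero by blast
  have disj: "BW \<inter> BV = {}" using PW PV nz by force
  have spanU: "span (BW \<union> BV) = UNIV"
  proof -
    have "x \<in> span (BW \<union> BV)" for x
    proof -
      have "P x \<in> span (BW \<union> BV)" using BW(3) span_mono[of BW "BW \<union> BV"] by blast
      moreover have "x - P x \<in> span (BW \<union> BV)"
      proof -
        have "x - P x \<in> {x. P x = 0}" by (simp add: diff PP)
        then show ?thesis using BV(3) span_mono[of BV "BW \<union> BV"] by blast
      qed
      ultimately have "P x + (x - P x) \<in> span (BW \<union> BV)" by (rule span_add)
      then show ?thesis by simp
    qed
    then show ?thesis by blast
  qed
  have "dim {x + y |x y. x \<in> range P \<and> y \<in> {x. P x = 0}} + dim (range P \<inter> {x. P x = 0})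
      = dim (range P) + dim {x. P x = 0}"
    by (rule dim_sums_Int[OF sW sV])
  moreover have "dim {x + y |x y. x \<in> range P \<and> y \<in> {x. P x = 0}} \<le> CARD('m)"
    using dim_subset_UNIV[of "{x + y |x y. x \<in> range P \<and> y \<in> {x. P x = 0}}"]
    unfolding DIM_cart DIM_real mult_1_right .
  ultimately have dims: "dim {x + y |x y. x \<in> range P \<and> y \<in> {x. P x = 0}} + dim (range P \<inter> {x. P x = 0})
      = dim (range P) + dim {x. P x = 0}" "dim {x + y |x y. x \<in> range P \<and> y \<in> {x. P x = 0}} \<le> CARD('m)"
    by blast+
  have "dim (range P) + dim {x. P x = 0} \<le> CARD('m)"
  proof -
    have "range P \<inter> {x. P x = 0} \<subseteq> {0}" using PP by auto
    then have "dim (range P \<inter> {x. P x = 0}) = 0" unfolding dim_eq_0 .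
    then show ?thesis using dims by linarith
  qed
  then have "card (BW \<union> BV) \<le> CARD('m)" using card_Un_disjoint[OF fin disj] BW BV by simp
  moreover have "CARD('m) \<le> card (BW \<union> BV)"
    using span_card_ge_dim[of "BW \<union> BV" UNIV] spanU fin by simp
  ultimately have "card (BW \<union> BV) = CARD('m)" by simp
  \<comment> \<open>Having exactly as many elements as there are coordinates, the adapted basis can
    be indexed by them; \<open>b\<close> then conjugates \<open>S a c\<close> to the diagonal map
    \<open>dg\<close>.\<close>
  then obtain h :: "'m \<Rightarrow> real^'m" where h: "bij_betw h UNIV (BW \<union> BV)"
    using finite_same_card_bij[of "UNIV :: 'm set" "BW \<union> BV"] fin by auto
  define b where "b x = (\<Sum>j\<in>UNIV. x $ j *\<^sub>R h j)" for x
  have linb: "linear b" unfolding b_def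
    by (intro linearI) (simp_all add: scaleR_add_left sum.distrib scaleR_sum_right)
  interpret b: linear b by (rule linb)
  have "surj b"
  proof -
    have "h j \<in> range b" for j
    proof -
      have "b (axis j 1) = h j" by (simp add: b_def axis_def if_distrib[of "\<lambda>z. z *\<^sub>R _"] sum.delta cong: if_cong)
      then show ?thesis by (metis rangeI)
    qed
    then have "range h \<subseteq> range b" by blast
    then have "BW \<union> BV \<subseteq> range b" using bij_betw_imp_surj_on[OF h] by simp
    then have "span (BW \<union> BV) \<subseteq> range b"
      by (intro span_minimal linear_subspace_image linb) auto
    then show ?thesis using spanU by auto
  qed
  then have detb: "det (matrix b) \<noteq> 0"
    using det_nz_iff_inj[OF linb] linear_surjective_imp_injective[OF linb] by simp
  define I where "I = {i. h i \<in> BW}"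
  define k where "k = card I"
  define l where "l = card (- I)"
  have BWne: "BW \<noteq> {}"
  proof
    assume "BW = {}"
    then have "P w0 \<in> span {}" using BW(3) by auto
    then show False using w0 by simp
  qed
  have "I \<noteq> {}"
  proof -
    obtain w where w: "w \<in> BW" using BWne by blast
    then obtain i where "w = h i" using h by (metis UnI1 bij_betw_imp_surj_on imageE)
    then show ?thesis using w by (auto simp: I_def)
  qed
  then have "1 \<le> k" by (simp add: k_def Suc_le_eq card_gt_0_iff)
  moreover have "det (matrix (S a c)) = a ^ k * c ^ l" for a c
  proof -
    define dg where "dg x = (\<chi> i. (if i \<in> I then a else c) * x $ i)" for x :: "real^'m"
    have lind: "linear dg" unfolding dg_def
      by (intro linearI) (simp_all add: vec_eq_iff algebra_simps)
    have "S a c (h i) = (if i \<in> I then a else c) *\<^sub>R h i" for i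
    proof -
      have "h i \<in> BW \<union> BV" using h by (rule bij_betw_apply) simp
      then show ?thesis using PW[of "h i"] PV[of "h i"] by (auto simp: S_def I_def)
    qed
    then have "S a c (b x) = b (dg x)" for x
      by (simp add: b_def linear_sum[OF linS] linear_scale[OF linS] dg_def mult.commute)
    then have "S a c \<circ> b = b \<circ> dg" by auto
    then have "det (matrix (S a c)) * det (matrix b) = det (matrix b) * det (matrix dg)"
      by (simp only: det_mul[symmetric] matrix_compose[OF linb linS, symmetric] matrix_compose[OF lind linb, symmetric])
    then have "det (matrix (S a c)) = det (matrix dg)" using detb by simp
    also have "\<dots> = (\<Prod>i\<in>UNIV. matrix dg $ i $ i)"
      by (rule det_diagonal) (simp add: matrix_def dg_def axis_def)
    also have "\<dots> = (\<Prod>i\<in>UNIV. if i \<in> I then a else c)"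
      by (intro prod.cong) (auto simp: matrix_def dg_def axis_def)
    also have "\<dots> = a ^ k * c ^ l" by (simp add: prod.If_cases k_def l_def Compl_eq)
    finally show ?thesis .
  qed
  ultimately show thesis unfolding S_def by (rule that)
qed

text \<open>Relative to range and kernel of \<open>P\<close> the map is block triangular, with
  \<open>P T\<close> on the range and the identity on the kernel. The off-diagonal block can be
  arbitrarily large while \<open>c\<close> must not depend on \<open>T\<close>, so the map is
  conjugated on the kernel by a scaling that makes this block small. The scaling cancels in the
  determinant.\<close>

lemma det_projection_lower:
  fixes P :: "real^'m::{finite,wellorder} \<Rightarrow> real^'m::_"
  assumes P: "linear P" and PP: "\<And>x. P (P x) = P x" and w0: "P w0 \<noteq> 0"
  obtains c where "0 < c"
    "\<forall>T m. linear T \<and> 1 \<le> m \<and> (\<forall>x. m * norm (P x) \<le> norm (P (T (P x)))) \<longrightarrow>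
      c * m \<le> \<bar>det (matrix (\<lambda>x. P (T x) + (x - P x)))\<bar>"
proof -
  interpret linear P by fact
  define S where "S a b x = a *\<^sub>R P x + b *\<^sub>R (x - P x)" for a b x
  have linS: "linear (S a b)" for a b
    unfolding S_def by (intro linearI) (simp_all add: add scale algebra_simps)
  obtain k l where kl: "1 \<le> k" "\<And>a b. det (matrix (S a b)) = a ^ k * b ^ l"
    using det_projection_scaling[OF assms] unfolding S_def by metis
  obtain B where B: "0 < B" "\<And>x. norm (P x) \<le> B * norm x"
    using linear_bounded_pos[OF P] by (auto simp: mult.commute)
  \<comment> \<open>The lower bound for \<open>Z\<close> below reads
    \<open>norm x / 2 \<le> (2 * B + 1) * norm (Z x)\<close>.\<close>
  define \<kappa> where "\<kappa> = 1 / (2 * (2 * B + 1))"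
  have kap: "\<kappa> > 0" using B by (simp add: \<kappa>_def)
  show thesis
  proof (rule that[of "\<kappa> ^ CARD('m)"], safe)
    show "0 < \<kappa> ^ CARD('m)" using kap by simp
    fix T :: "(real,'m) vec \<Rightarrow> (real,'m) vec" and m :: real assume T: "linear T" and m: "1 \<le> m"
      and le: "\<forall>x. m * norm (P x) \<le> norm (P (T (P x)))"
    interpret T: linear T by fact
    define A where "A x = P (T x) + (x - P x)" for x
    have linA: "linear A" unfolding A_def
      by (intro linearI) (simp_all add: add scale T.add T.scale algebra_simps)
    have linN: "linear (\<lambda>x. P (T (x - P x)))"
      by (intro linearI) (simp_all add: add scale diff T.add T.scale T.diff algebra_simps)
    obtain K where K: "0 < K" "\<And>x. norm (P (T (x - P x))) \<le> K * norm x"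
      using linear_bounded_pos[OF linN] by (auto simp: mult.commute)
    define \<eta> where "\<eta> = 1 / (2 * K)"
    have lam: "\<eta> > 0" using K by (simp add: \<eta>_def)
    \<comment> \<open>\<open>1/m\<close> normalises the range block to expand at least by 1, and
      \<open>\<eta>\<close> reduces the off-diagonal block to norm at most \<open>1/2\<close>. In
      the determinant the powers of \<open>\<eta>\<close> cancel and \<open>(1/m) ^ k\<close>
      remains.\<close>
    define Z where "Z = S 1 (1/\<eta>) \<circ> (A \<circ> S (1/m) \<eta>)"
    have linZ: "linear Z" unfolding Z_def by (intro linear_compose linS linA)
    have AS: "A (S (1/m) \<eta> x) = (1/m) *\<^sub>R P (T (P x)) + \<eta> *\<^sub>R P (T (x - P x)) + \<eta> *\<^sub>R (x - P x)" for x
      by (simp add: A_def S_def add scale diff PP T.add T.scale T.diff algebra_simps)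
    have Z_eq: "Z x = (1/m) *\<^sub>R P (T (P x)) + \<eta> *\<^sub>R P (T (x - P x)) + (x - P x)" for x
      using lam unfolding Z_def o_def AS by (simp add: S_def add scale diff PP algebra_simps)
    have "\<kappa> * norm x \<le> norm (Z x)" for x
    proof -
      have PZ: "P (Z x) = (1/m) *\<^sub>R P (T (P x)) + \<eta> *\<^sub>R P (T (x - P x))"
        by (simp add: Z_eq add scale diff PP)
      have QZ: "Z x - P (Z x) = x - P x" unfolding PZ by (simp add: Z_eq)
      have "norm (P x) \<le> norm ((1/m) *\<^sub>R P (T (P x)))" using le[THEN spec, of x] m by (simp add: field_simps)
      moreover have "norm (\<eta> *\<^sub>R P (T (x - P x))) \<le> norm x / 2"
        using mult_left_mono[OF K(2)[of x], of \<eta>] lam K by (simp add: \<eta>_def)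
      ultimately have "norm (P x) - norm x / 2 \<le> norm (P (Z x))"
        unfolding PZ
        using norm_triangle_ineq2[of "(1/m) *\<^sub>R P (T (P x))" "- \<eta> *\<^sub>R P (T (x - P x))"] by simp
      moreover have "norm (P (Z x)) \<le> B * norm (Z x)" by (rule B)
      moreover have "norm (x - P x) \<le> norm (Z x) + B * norm (Z x)"
        using norm_triangle_ineq4[of "Z x" "P (Z x)"] B(2)[of "Z x"] unfolding QZ by simp
      moreover have "norm x \<le> norm (P x) + norm (x - P x)"
        using norm_triangle_ineq[of "P x" "x - P x"] by simp
      ultimately have "norm x / 2 \<le> (2 * B + 1) * norm (Z x)" by (simp add: algebra_simps)
      then show ?thesis using B by (simp add: \<kappa>_def field_simps)
    qed
    then have "\<kappa> ^ CARD('m) \<le> \<bar>det (matrix Z)\<bar>" by (intro det_ge_power linZ kap)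
    also have "det (matrix Z) = (1/\<eta>) ^ l * det (matrix A) * ((1/m) ^ k * \<eta> ^ l)"
      unfolding Z_def
      by (simp add: matrix_compose linear_compose linS linA det_mul kl)
    also have "\<dots> = det (matrix A) * (1/m) ^ k" using lam by (simp add: field_simps power_divide)
    also have "\<bar>\<dots>\<bar> \<le> \<bar>det (matrix A)\<bar> * (1/m)"
      using m kl(1) power_decreasing[of 1 k "1/m"]
        mult_left_mono[of "(1/m) ^ k" "1/m" "\<bar>det (matrix A)\<bar>"] by (simp add: abs_mult)
    finally show "\<kappa> ^ CARD('m) * m \<le> \<bar>det (matrix (\<lambda>x. P (T x) + (x - P x)))\<bar>"
      using m unfolding A_def[abs_def, symmetric] by (simp add: field_simps A_def[abs_def])
  qed
qed

section \<open>Points at which the expansion is slow at all times\<close>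

text \<open>The series of the \<open>p ^ j * J j x\<close> has integral at most
  \<open>V / (1 - p)\<close>, so it is finite almost everywhere, in particular at some point of the
  box, and its sum bounds every term there.\<close>

lemma exists_weighted_bound:
  fixes J :: "nat \<Rightarrow> 'a::euclidean_space \<Rightarrow> real"
  assumes ne: "box a b \<noteq> {}" and p: "0 < p" "p < 1"
    and cont: "\<And>j. continuous_on (cbox a b) (J j)"
    and nonneg: "\<And>j x. x \<in> cbox a b \<Longrightarrow> 0 \<le> J j x"
    and int: "\<And>j. integral (cbox a b) (J j) \<le> V"
  obtains x K where "x \<in> cbox a b" "\<forall>j. p ^ j * J j x \<le> K"
proof -
  let ?S = "cbox a b"
  define g where "g j x = ennreal (indicator ?S x *\<^sub>R (p ^ j * J j x))" for j x
  have gm: "g j \<in> borel_measurable lborel" for j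
    unfolding g_def measurable_lborel2
    by (intro measurable_compose[OF _ measurable_ennreal] borel_measurable_continuous_on_indicator)
      (auto intro!: continuous_intros cont)
  have V0: "0 \<le> V" using integral_nonneg[OF integrable_continuous[OF cont[of 0]] nonneg] int[of 0] by linarith
  have gi: "integral\<^sup>N lborel (g j) \<le> ennreal (p ^ j * V)" for j
  proof -
    have "((\<lambda>x. p ^ j * J j x) has_integral p ^ j * integral ?S (J j)) ?S"
      by (intro has_integral_mult_right integrable_integral integrable_continuous cont)
    then have "integral\<^sup>N lborel (\<lambda>x. ennreal (p ^ j * J j x) * indicator ?S x) = ennreal (p ^ j * integral ?S (J j))"
      by (intro nn_integral_has_integral_lebesgue') (use nonneg p in auto)
    moreover have "g j = (\<lambda>x. ennreal (p ^ j * J j x) * indicator ?S x)"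
      by (auto simp: g_def indicator_def)
    ultimately have "integral\<^sup>N lborel (g j) = ennreal (p ^ j * integral ?S (J j))" by simp
    also have "\<dots> \<le> ennreal (p ^ j * V)" using int p by (intro ennreal_leI mult_left_mono) auto
    finally show ?thesis .
  qed
  have sm: "(\<Sum>j. ennreal (p ^ j * V)) \<noteq> \<infinity>"
    using p V0 by (subst suminf_ennreal_eq[where x = "V / (1 - p)"])
      (use sums_mult2[OF geometric_sums[of p], of V] in auto)
  have "integral\<^sup>N lborel (\<lambda>x. \<Sum>j. g j x) = (\<Sum>j. integral\<^sup>N lborel (g j))"
    by (rule nn_integral_suminf) (rule gm)
  also have "\<dots> \<le> (\<Sum>j. ennreal (p ^ j * V))" by (intro suminf_le gi) auto
  finally have "integral\<^sup>N lborel (\<lambda>x. \<Sum>j. g j x) \<noteq> \<infinity>" using sm by (auto simp: top_unique)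
  then have ae: "AE x in lborel. (\<Sum>j. g j x) \<noteq> \<infinity>"
    by (intro nn_integral_PInf_AE borel_measurable_suminf_order gm) auto
  have "\<exists>x\<in>?S. (\<Sum>j. g j x) \<noteq> \<infinity>"
  proof (rule ccontr)
    assume "\<not> ?thesis"
    then have "AE x in lborel. x \<notin> ?S" using ae by (auto elim!: eventually_mono)
    then have "?S \<in> null_sets lborel" by (intro AE_iff_null_sets[THEN iffD2]) auto
    then have "measure lborel ?S = 0" by (simp add: measure_def null_sets_def)
    then show False using ne content_pos_lt_eq[of a b] by (auto simp: box_ne_empty)
  qed
  then obtain x where x: "x \<in> ?S" "(\<Sum>j. g j x) \<noteq> \<infinity>" by blast
  show thesis
  proof (rule that[OF x(1)], rule allI)
    fix j
    have "g j x \<le> (\<Sum>j. g j x)" using sum_le_suminf[of "\<lambda>j. g j x" "{j}"] by simp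
    also have "\<dots> = ennreal (enn2real (\<Sum>j. g j x))" using x(2) by (simp add: top.not_eq_extremum)
    finally have "ennreal (p ^ j * J j x) \<le> ennreal (enn2real (\<Sum>j. g j x))" using x(1) by (simp add: g_def)
    then show "p ^ j * J j x \<le> enn2real (\<Sum>j. g j x)" by (simp add: ennreal_le_iff)
  qed
qed

text \<open>\<open>H j\<close> is injective with image in a fixed ball, so its Jacobians have
  uniformly bounded integrals, and at some point they grow at most like \<open>p ^ - j\<close>. By
  \<open>det_projection_lower\<close> a Jacobian of this size forces some unit vector of the range
  of \<open>P\<close> to be expanded no faster.\<close>

lemma exists_point_slow_expansion_wo:
  fixes F :: "nat \<Rightarrow> (real,'m::{finite,wellorder}) vec \<Rightarrow> (real,'m) vec" and P :: "(real,'m) vec \<Rightarrow> (real,'m) vec"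
  assumes P: "linear P" and PP: "\<And>x. P (P x) = P x" and w0: "P w0 \<noteq> 0"
    and U: "open U" "U \<noteq> {}" "bounded U" and p: "0 < p" "p < 1"
    and bnd: "\<And>j x. x \<in> U \<Longrightarrow> norm (F j x) \<le> R"
    and der: "\<And>j x. x \<in> U \<Longrightarrow> (F j has_derivative F' j x) (at x)"
    and cont: "\<And>j v. continuous_on U (\<lambda>x. F' j x v)"
    and inj: "\<And>j x y. x \<in> U \<Longrightarrow> y \<in> U \<Longrightarrow> x - P x = y - P y \<Longrightarrow> P (F j x) = P (F j y) \<Longrightarrow> x = y"
  obtains x K where "x \<in> U" "\<And>j. \<exists>w. P w = w \<and> norm w = 1 \<and> p ^ j * norm (P (F' j x w)) \<le> K"
proof -
  interpret linear P by fact
  obtain c where c: "0 < c" "\<forall>T m. linear T \<and> 1 \<le> m \<and> (\<forall>x. m * norm (P x) \<le> norm (P (T (P x)))) \<longrightarrow>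
      c * m \<le> \<bar>det (matrix (\<lambda>x. P (T x) + (x - P x)))\<bar>"
    by (rule det_projection_lower[OF P PP w0])
  obtain B where B: "0 < B" "\<And>x. norm (P x) \<le> B * norm x"
    using linear_bounded_pos[OF P] by (auto simp: mult.commute)
  obtain u where u: "u \<in> U" using U by blast
  obtain a b where ab: "u \<in> box a b" "cbox a b \<subseteq> U"
    using open_contains_cbox[OF U(1) u] by (metis)
  obtain R2 where R2: "\<And>x. x \<in> U \<Longrightarrow> norm x \<le> R2" using U(3) bounded_iff by blast
  define H where "H j x = P (F j x) + (x - P x)" for j x
  define A where "A j x v = P (F' j x v) + (v - P v)" for j x v
  define J where "J j x = \<bar>det (matrix (A j x))\<bar>" for j x
  have linF: "linear (F' j x)" if "x \<in> U" for j x
    using der[OF that] has_derivative_linear by blast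
  have derH: "(H j has_derivative A j x) (at x)" if "x \<in> U" for j x
  proof -
    have bl: "bounded_linear P" using P by (simp add: linear_conv_bounded_linear)
    show ?thesis unfolding H_def[abs_def] A_def[abs_def]
      by (intro has_derivative_add has_derivative_diff has_derivative_ident
          bounded_linear.has_derivative[OF bl] der that)
  qed
  \<comment> \<open>Applying \<open>P\<close> to \<open>H j x\<close> recovers
    \<open>P (F j x)\<close>, and the remainder is \<open>x - P x\<close>; the two together
    determine \<open>x\<close> by hypothesis.\<close>
  have injH: "inj_on (H j) U" for j
  proof (rule inj_onI)
    fix x y assume xy: "x \<in> U" "y \<in> U" "H j x = H j y"
    have "P (H j x) = P (F j x)" "P (H j y) = P (F j y)" by (simp_all add: H_def add diff PP)
    then have "P (F j x) = P (F j y)" using xy(3) by simp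
    moreover have "x - P x = y - P y" using xy(3) calculation by (simp add: H_def)
    ultimately show "x = y" using inj xy by blast
  qed
  define R3 where "R3 = B * R + (R2 + B * R2)"
  have Hb: "H j ` cbox a b \<subseteq> cball 0 R3" for j
  proof
    fix y assume "y \<in> H j ` cbox a b"
    then obtain x where x: "x \<in> U" "y = H j x" using ab by auto
    have "norm (P (F j x)) \<le> B * R" using B(2)[of "F j x"] mult_left_mono[OF bnd[OF x(1), of j], of B] B(1) by linarith
    moreover have "norm (x - P x) \<le> R2 + B * R2"
      using norm_triangle_ineq4[of x "P x"] B(2)[of x] mult_left_mono[OF R2[OF x(1)], of B] B(1) R2[OF x(1)] by linarith
    ultimately have "norm (H j x) \<le> R3" unfolding H_def R3_def by (intro norm_triangle_le add_mono)
    then show "y \<in> cball 0 R3" using x by simp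
  qed
  have contJ: "continuous_on (cbox a b) (J j)" for j
  proof -
    have "continuous_on (cbox a b) (\<lambda>x. A j x v)" for v
      unfolding A_def using P
      by (intro continuous_intros linear_continuous_on_compose[OF _ P] continuous_on_subset[OF cont ab(2)])
    then show ?thesis unfolding J_def det_def matrix_def
      by (intro continuous_intros) simp
  qed
  have intJ: "J j integrable_on cbox a b" for j using contJ integrable_continuous by blast
  have "integral (cbox a b) (J j) \<le> measure lebesgue (cball (0::(real,'m) vec) R3)" for j
  proof -
    have der': "(H j has_derivative A j x) (at x within cbox a b)" if "x \<in> cbox a b" for x
      using derH ab(2) that has_derivative_at_withinI by blast
    have inj': "inj_on (H j) (cbox a b)" using injH ab(2) inj_on_subset by blast
    have "measure lebesgue (H j ` cbox a b) = integral (cbox a b) (J j)"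
      using measure_differentiable_image_eq[OF _ der' inj'] intJ unfolding J_def by simp
    moreover have "H j ` cbox a b \<in> lmeasurable"
      using measurable_differentiable_image_eq[OF _ der' inj'] intJ unfolding J_def by simp
    ultimately show ?thesis using measure_mono_fmeasurable[OF Hb[of j] fmeasurableD lmeasurable_cball] by simp
  qed
  then obtain x K where x: "x \<in> cbox a b" "\<forall>j. p ^ j * J j x \<le> K"
  proof (rule exists_weighted_bound[where J = J, OF _ p contJ, rotated 2])
    show "box a b \<noteq> {}" using ab(1) by blast
    show "0 \<le> J j x" for j x by (simp add: J_def)
  qed
  have xU: "x \<in> U" using x ab by blast
  show thesis
  proof (rule that[OF xU])
    fix j
    \<comment> \<open>The summand 1 makes \<open>c * m\<close> exceed \<open>J j x\<close>, so not
      every unit vector of the range can be expanded by \<open>m\<close> or more.\<close>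
    define m where "m = 1 + J j x / c"
    have m: "1 \<le> m" using c(1) by (simp add: m_def J_def)
    have "\<exists>w. P w = w \<and> norm w = 1 \<and> norm (P (F' j x w)) < m"
    proof (rule ccontr)
      assume neg: "\<not> ?thesis"
      interpret F: linear "F' j x" by (rule linF[OF xU])
      have "m * norm (P z) \<le> norm (P (F' j x (P z)))" for z
      proof (cases "P z = 0")
        case False
        define w where "w = (1 / norm (P z)) *\<^sub>R P z"
        have "P w = w" "norm w = 1" using False by (simp_all add: w_def scale PP)
        then have "m \<le> norm (P (F' j x w))" using neg by force
        also have "\<dots> = norm (P (F' j x (P z))) / norm (P z)" by (simp add: w_def scale F.scale)
        finally show ?thesis using False by (simp add: field_simps)
      qed simp
      then have "c * m \<le> J j x" unfolding J_def A_def using c(2) linF[OF xU] m by blast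
      moreover have "c * m = c + J j x" using c(1) by (simp add: m_def field_simps)
      ultimately show False using c(1) by simp
    qed
    then obtain w where w: "P w = w" "norm w = 1" "norm (P (F' j x w)) < m" by blast
    have "p ^ j * norm (P (F' j x w)) \<le> p ^ j * m" using w p by (intro mult_left_mono) auto
    also have "\<dots> = p ^ j + p ^ j * J j x / c" by (simp add: m_def algebra_simps)
    also have "\<dots> \<le> 1 + K / c" using x(2)[THEN spec, of j] c(1) p
      by (intro add_mono divide_right_mono) (auto simp: power_le_one)
    finally show "\<exists>w. P w = w \<and> norm w = 1 \<and> p ^ j * norm (P (F' j x w)) \<le> 1 + K / c" using w by blast
  qed
qed

text \<open>All data are conjugated by a linear isometry onto the space with well-ordered index
  type, which leaves norms and constants unchanged.\<close>

lemma exists_point_slow_expansion: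
  fixes F :: "nat \<Rightarrow> real^'n \<Rightarrow> real^'n" and P :: "real^'n \<Rightarrow> real^'n"
  assumes P: "linear P" and PP: "\<And>x. P (P x) = P x" and w0: "P w0 \<noteq> 0"
    and U: "open U" "U \<noteq> {}" "bounded U" and p: "0 < p" "p < 1"
    and bnd: "\<And>j x. x \<in> U \<Longrightarrow> norm (F j x) \<le> R"
    and der: "\<And>j x. x \<in> U \<Longrightarrow> (F j has_derivative F' j x) (at x)"
    and cont: "\<And>j v. continuous_on U (\<lambda>x. F' j x v)"
    and inj: "\<And>j x y. x \<in> U \<Longrightarrow> y \<in> U \<Longrightarrow> x - P x = y - P y \<Longrightarrow> P (F j x) = P (F j y) \<Longrightarrow> x = y"
  obtains x K where "x \<in> U" "\<And>j. \<exists>w. P w = w \<and> norm w = 1 \<and> p ^ j * norm (P (F' j x w)) \<le> K"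
proof -
  have dims: "DIM(real^'n) = DIM(real^'n wo_copy)" by (simp add: card_wo_copy)
  obtain f :: "real^'n \<Rightarrow> real^'n wo_copy" and g where fg: "linear f" "linear g"
    "\<And>x. norm (f x) = norm x" "\<And>y. norm (g y) = norm y" "\<And>x. g (f x) = x" "\<And>y. f (g y) = y"
    using isomorphisms_UNIV_UNIV[OF dims] by metis
  interpret P: linear P by fact
  interpret f: linear f by (rule fg)
  interpret g: linear g by (rule fg)
  have blf: "bounded_linear f" and blg: "bounded_linear g"
    using fg by (simp_all add: linear_conv_bounded_linear)
  have eqf: "f x = f y \<longleftrightarrow> x = y" for x y by (metis fg(5))
  have gU: "g y \<in> U" if "y \<in> f ` U" for y using that by (auto simp: fg)
  obtain y K where y: "y \<in> f ` U" and K: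
    "\<And>j. \<exists>w. (f \<circ> P \<circ> g) w = w \<and> norm w = 1 \<and> p ^ j * norm ((f \<circ> P \<circ> g) ((\<lambda>v. f (F' j (g y) (g v))) w)) \<le> K"
  proof (rule exists_point_slow_expansion_wo[of "f \<circ> P \<circ> g" "f w0" "f ` U" p
        "\<lambda>j x. f (F j (g x))" R "\<lambda>j x v. f (F' j (g x) (g v))"])
    show "linear (f \<circ> P \<circ> g)" by (intro linear_compose fg P)
    show "open (f ` U)"
      using U(1) fg by (intro open_surjective_linear_image) (auto simp: surj_def, metis)
    show "bounded (f ` U)" using U(3) blf by (rule bounded_linear_image)
    show "((\<lambda>x. f (F j (g x))) has_derivative (\<lambda>v. f (F' j (g x) (g v)))) (at x)" if "x \<in> f ` U" for j x
      by (rule bounded_linear.has_derivative[OF blf]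
          has_derivative_compose[OF bounded_linear.has_derivative[OF blg has_derivative_ident] der[OF gU[OF that]]])+
    show "continuous_on (f ` U) (\<lambda>x. f (F' j (g x) (g v)))" for j v
      by (intro linear_continuous_on_compose[OF _ fg(1)] continuous_on_compose2[OF cont]
          linear_continuous_on blg) (auto simp: fg)
    show "x = y" if "x \<in> f ` U" "y \<in> f ` U" "x - (f \<circ> P \<circ> g) x = y - (f \<circ> P \<circ> g) y"
      "(f \<circ> P \<circ> g) (f (F j (g x))) = (f \<circ> P \<circ> g) (f (F j (g y)))" for j x y
    proof -
      have "g (x - f (P (g x))) = g (y - f (P (g y)))" using that(3) by simp
      then have "g x - P (g x) = g y - P (g y)" by (simp add: g.diff fg)
      moreover have "P (F j (g x)) = P (F j (g y))" using that(4) by (simp add: fg eqf)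
      ultimately have "g x = g y" using inj gU that(1,2) by blast
      then show ?thesis by (metis fg(6))
    qed
    show "(f \<circ> P \<circ> g) (f w0) \<noteq> 0" using w0 eqf[of "P w0" 0] by (simp add: fg f.zero)
  qed (use U p PP bnd fg gU in \<open>auto\<close>)
  show thesis
  proof (rule that[OF gU[OF y]])
    fix j
    obtain w where w: "f (P (g w)) = w" "norm w = 1" "p ^ j * norm (f (P (F' j (g y) (g w)))) \<le> K"
      using K[of j] by (auto simp: fg)
    then show "\<exists>w. P w = w \<and> norm w = 1 \<and> p ^ j * norm (P (F' j (g y) w)) \<le> K"
      by (intro exI[of _ "g w"]) (metis fg(3,4,5))
  qed
qed

subsection \<open>Differentiability in time\<close>

context cone_flow
begin

text \<open>The vector field of the flow. Only differentiability in space is assumed, so this is an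
  unspecified value until \<open>velocity_estimate\<close> shows that the derivative exists on
  \<open>X\<close>.\<close>

definition velocity :: "'a \<Rightarrow> 'a" where
  "velocity x = vector_derivative (\<lambda>t. \<Phi> t x) (at 0)"

text \<open>The bound \<open>1/2\<close> makes the average of \<open>D s x\<close> over
  \<open>[0, h]\<close> invertible.\<close>

lemma D_near_identity:
  obtains h where "0 < h" "h \<le> 1"
    "\<And>s x v. 0 \<le> s \<Longrightarrow> s \<le> h \<Longrightarrow> x \<in> X \<Longrightarrow> norm (D s x v - v) \<le> norm v / 2"
proof -
  let ?f = "\<lambda>(s, x). D s x"
  have "uniformly_continuous_on ({0..1} \<times> X) ?f"
    by (intro compact_uniformly_continuous continuous_on_subset[OF D_continuous] compact_Times X_compact) auto
  then obtain d where d: "d > 0"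
    "\<And>p q. p \<in> {0..1} \<times> X \<Longrightarrow> q \<in> {0..1} \<times> X \<Longrightarrow> dist q p < d \<Longrightarrow> dist (?f q) (?f p) < 1/2"
    unfolding uniformly_continuous_on_def by (metis half_gt_zero_iff zero_less_one)
  show thesis
  proof (rule that[of "min 1 (d/2)"])
    fix s :: real and x v :: 'a assume s: "0 \<le> s" "s \<le> min 1 (d/2)" and x: "x \<in> X"
    have "dist (D s x) (D 0 x) < 1/2" using d(2)[of "(0,x)" "(s,x)"] s x d(1) by (auto simp: dist_Pair_Pair)
    then have "norm (D s x - D 0 x) \<le> 1/2" by (simp add: dist_norm)
    then have "norm (D s x - D 0 x) * norm v \<le> 1/2 * norm v" by (intro mult_right_mono) auto
    moreover have "D s x v - v = (D s x - D 0 x) v" by (simp add: blinfun.diff_left D_0)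
    ultimately show "norm (D s x v - v) \<le> norm v / 2"
      using norm_blinfun[of "D s x - D 0 x" v] by simp
  qed (use d in auto)
qed

text \<open>Differentiability in time comes from averaging: \<open>G y = \<integral>\<^sub>0\<^sup>h \<Phi>\<^sub>s y ds\<close> has an invertible derivative
  in \<open>y\<close>, while \<open>G (\<Phi>\<^sub>t x)\<close> is differentiable in \<open>t\<close>.\<close>

lemma flow_time_derivative_at_0:
  assumes h: "0 < h" "h \<le> 1" and near: "\<And>s v. 0 \<le> s \<Longrightarrow> s \<le> h \<Longrightarrow> norm (D s x v - v) \<le> norm v / 2"
  obtains w where "((\<lambda>t. \<Phi> t x) has_vector_derivative w) (at 0)" "norm w \<le> 2 / h * norm (\<Phi> h x - x)"
proof -
  define \<phi> where "\<phi> t = \<Phi> t x" for t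
  have cphi: "continuous_on S \<phi>" for S
    unfolding \<phi>_def by (intro continuous_flow_comp continuous_intros)
  define G where "G y = integral {0..h} (\<lambda>s. \<Phi> s y)" for y
  define A where "A = integral {0..h} (\<lambda>s. D s x)"
  have Dint: "(\<lambda>s. D s x) integrable_on {0..h}"
    by (intro integrable_continuous_interval continuous_D_comp continuous_intros)
  have GA: "(G has_derivative blinfun_apply A) (at x)"
  proof -
    have "((\<lambda>y. integral (cbox 0 h) (\<lambda>s. \<Phi> s y)) has_derivative blinfun_apply (integral (cbox 0 h) (\<lambda>s. D s x))) (at x within UNIV)"
      by (rule leibniz_rule[where f = "\<lambda>y s. \<Phi> s y" and fx = "\<lambda>y s. D s y"])
        (auto intro!: flow_derivative integrable_continuous_interval continuous_flow_comp continuous_D_comp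
          continuous_intros simp: case_prod_beta)
    then show ?thesis by (simp add: G_def[abs_def] A_def)
  qed
  have Alow: "h / 2 * norm v \<le> norm (A v)" for v
  proof -
    have "((\<lambda>s. D s x v) has_integral A v) {0..h}"
      unfolding A_def using has_integral_linear[OF integrable_integral[OF Dint] blinfun.bounded_linear_left[of v]]
      by (simp add: o_def)
    moreover have "((\<lambda>s. v) has_integral h *\<^sub>R v) {0..h}" using has_integral_const_real[of v 0 h] h by simp
    ultimately have "((\<lambda>s. D s x v - v) has_integral (A v - h *\<^sub>R v)) {0..h}" by (rule has_integral_diff)
    then have "norm (A v - h *\<^sub>R v) \<le> norm v / 2 * measure lborel (cbox 0 h)"
      by (intro has_integral_bound) (use near in auto)
    then have "norm (A v - h *\<^sub>R v) \<le> h / 2 * norm v" using h by (simp add: mult.commute)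
    moreover have "norm (h *\<^sub>R v) \<le> norm (A v) + norm (A v - h *\<^sub>R v)"
      using norm_triangle_ineq4[of "A v" "A v - h *\<^sub>R v"] by simp
    ultimately show ?thesis using h by simp
  qed
  have linA: "linear (blinfun_apply A)" by (simp add: blinfun.bounded_linear_right bounded_linear.linear)
  have "inj (blinfun_apply A)"
    unfolding linear_injective_0[OF linA] using Alow h
    by (metis divide_pos_pos mult_le_0_iff norm_le_zero_iff norm_zero not_less zero_less_numeral)
  \<comment> \<open>By the chain rule \<open>A w\<close> must equal the derivative of
    \<open>G (\<phi> t)\<close> at 0, which is \<open>\<phi> h - \<phi> 0\<close>; this determines
    the candidate \<open>w\<close>.\<close>
  then obtain w where w: "A w = \<phi> h - \<phi> 0"
    using linear_injective_imp_surjective[OF linA] by (metis surjD)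
  \<comment> \<open>An antiderivative on \<open>[-1, 2]\<close>, so that \<open>t\<close> and
    \<open>h + t\<close> are interior points for all \<open>\<bar>t\<bar> < 1\<close>.\<close>
  define F where "F t = integral {-1..t} \<phi>" for t
  have F': "(F has_vector_derivative \<phi> t) (at t within {-1..2})" if "t \<in> {-1..2}" for t
    unfolding F_def by (rule integral_has_vector_derivative[OF cphi that])
  have Fat: "(F has_vector_derivative \<phi> t) (at t)" if "-1 < t" "t < 2" for t
  proof -
    have "(F has_vector_derivative \<phi> t) (at t within {-1<..<2})"
      by (rule has_vector_derivative_within_subset[OF F']) (use that in auto)
    then show ?thesis using that by (simp add: at_within_open[of t "{-1<..<2}"])
  qed
  have GF: "G (\<phi> t) = F (h + t) - F t" if "\<bar>t\<bar> < 1" for t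
  proof -
    have "((\<lambda>s. \<phi> (s + t)) has_integral F (h + t) - F (0 + t)) {0..h}"
    proof (rule fundamental_theorem_of_calculus)
      fix s assume s: "s \<in> {0..h}"
      have "((F \<circ> (\<lambda>s. s + t)) has_vector_derivative 1 *\<^sub>R \<phi> (s + t)) (at s)"
        by (rule vector_diff_chain_at) (use s h that in \<open>auto intro!: Fat derivative_eq_intros\<close>)
      then show "((\<lambda>s. F (s + t)) has_vector_derivative \<phi> (s + t)) (at s within {0..h})"
        by (auto simp: o_def intro: has_vector_derivative_at_within)
    qed (use h in auto)
    moreover have "\<phi> (s + t) = \<Phi> s (\<phi> t)" for s unfolding \<phi>_def by (rule flow_add)
    ultimately show ?thesis unfolding G_def by (simp add: integral_unique)
  qed
  have Kd: "((\<lambda>t. F (h + t) - F t) has_vector_derivative (\<phi> h - \<phi> 0)) (at 0)"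
  proof -
    have "((F \<circ> (\<lambda>t. h + t)) has_vector_derivative 1 *\<^sub>R \<phi> (h + 0)) (at 0)"
      by (rule vector_diff_chain_at) (use h in \<open>auto intro!: Fat derivative_eq_intros\<close>)
    moreover have "(F has_vector_derivative \<phi> 0) (at 0)" by (rule Fat) auto
    ultimately show ?thesis by (intro has_vector_derivative_diff) (auto simp: o_def)
  qed
  have "((\<lambda>t. \<phi> t) has_vector_derivative w) (at 0)"
    unfolding has_vector_derivative_def has_derivative_at_alt
  proof (intro conjI allI impI)
    show "bounded_linear (\<lambda>t. t *\<^sub>R w)" by (rule bounded_linear_scaleR_left)
    fix e :: real assume e: "0 < e"
    \<comment> \<open>The bound \<open>h / 4\<close> lets half of the lower bound for
      \<open>A\<close> absorb the error proportional to the remainder; the other entry bounds what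
      is left by \<open>e\<close>.\<close>
    define \<epsilon> where "\<epsilon> = min (h / 4) (e * (h / 4) / (1 + norm w))"
    have nw: "0 < 1 + norm w" by (simp add: add_pos_nonneg)
    have eps: "\<epsilon> > 0" "\<epsilon> \<le> h / 4" "\<epsilon> * (1 + norm w) \<le> e * (h / 4)"
    proof -
      show "\<epsilon> > 0" using e h nw by (simp add: \<epsilon>_def)
      show "\<epsilon> \<le> h / 4" unfolding \<epsilon>_def by (rule min.cobounded1)
      have "\<epsilon> \<le> e * (h / 4) / (1 + norm w)" unfolding \<epsilon>_def by (rule min.cobounded2)
      then show "\<epsilon> * (1 + norm w) \<le> e * (h / 4)" using nw by (simp only: pos_le_divide_eq)
    qed
    obtain d1 where d1: "d1 > 0" "\<And>y. norm (y - x) < d1 \<Longrightarrow> norm (G y - G x - A (y - x)) \<le> \<epsilon> * norm (y - x)"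
      using GA eps(1) unfolding has_derivative_at_alt by metis
    obtain d2 where d2: "d2 > 0" "\<And>t. norm (t - 0) < d2 \<Longrightarrow>
      norm (F (h + t) - F t - (F (h + 0) - F 0) - (t - 0) *\<^sub>R (\<phi> h - \<phi> 0)) \<le> \<epsilon> * norm (t - 0)"
      using Kd eps(1) unfolding has_vector_derivative_def has_derivative_at_alt by metis
    have "isCont \<phi> 0" using cphi[of UNIV] by (simp add: continuous_on_eq_continuous_at)
    then obtain d3 where d3: "d3 > 0" "\<And>t. norm (t - 0) < d3 \<Longrightarrow> norm (\<phi> t - \<phi> 0) < d1"
      unfolding continuous_at_eps_delta dist_norm using d1(1) by metis
    have p0: "\<phi> 0 = x" by (simp add: \<phi>_def flow_0)
    show "\<exists>d>0. \<forall>t. norm (t - 0) < d \<longrightarrow> norm (\<phi> t - \<phi> 0 - (t - 0) *\<^sub>R w) \<le> e * norm (t - 0)"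
    proof (intro exI[of _ "min 1 (min d2 d3)"] conjI allI impI)
      show "0 < min 1 (min d2 d3)" using d2 d3 by simp
      fix t :: real assume t: "norm (t - 0) < min 1 (min d2 d3)"
      let ?r = "\<phi> t - x - t *\<^sub>R w"
      have a: "norm (G (\<phi> t) - G x - A (\<phi> t - x)) \<le> \<epsilon> * norm (\<phi> t - x)"
        using d1(2)[of "\<phi> t"] d3(2)[of t] t p0 by simp
      have b: "norm (G (\<phi> t) - G x - t *\<^sub>R (\<phi> h - \<phi> 0)) \<le> \<epsilon> * \<bar>t\<bar>"
        using d2(2)[of t] t GF[of t] GF[of 0] p0 by simp
      have "A ?r = (G (\<phi> t) - G x - t *\<^sub>R (\<phi> h - \<phi> 0)) - (G (\<phi> t) - G x - A (\<phi> t - x))"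
        by (simp add: blinfun.diff_right blinfun.scaleR_right w)
      then have "norm (A ?r) \<le> \<epsilon> * \<bar>t\<bar> + \<epsilon> * norm (\<phi> t - x)"
        using norm_triangle_ineq4 a b by (smt (verit))
      moreover have "norm (\<phi> t - x) \<le> norm ?r + \<bar>t\<bar> * norm w"
        using norm_triangle_ineq[of ?r "t *\<^sub>R w"] by simp
      then have "\<epsilon> * norm (\<phi> t - x) \<le> \<epsilon> * (norm ?r + \<bar>t\<bar> * norm w)" using eps by (intro mult_left_mono) auto
      moreover have "\<epsilon> * norm ?r \<le> h / 4 * norm ?r" using eps by (intro mult_right_mono) auto
      ultimately have "h / 4 * norm ?r \<le> \<bar>t\<bar> * (\<epsilon> * (1 + norm w))"
        using Alow[of ?r] by (simp add: algebra_simps)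
      also have "\<dots> \<le> \<bar>t\<bar> * (e * (h / 4))" using eps(3) by (intro mult_left_mono) auto
      finally have "h / 4 * norm ?r \<le> h / 4 * (e * \<bar>t\<bar>)" by (simp add: mult_ac)
      then have "norm ?r \<le> e * \<bar>t\<bar>" using h by simp
      then show "norm (\<phi> t - \<phi> 0 - (t - 0) *\<^sub>R w) \<le> e * norm (t - 0)" by (simp add: p0)
    qed
  qed
  moreover have "norm w \<le> 2 / h * norm (\<Phi> h x - x)"
    using Alow[of w] h unfolding w by (simp add: \<phi>_def flow_0 field_simps)
  ultimately show thesis by (intro that) (auto simp: \<phi>_def)
qed

text \<open>The velocity is bounded by an honest displacement, so it is small near equilibria
  without any appeal to its continuity.\<close>

lemma velocity_estimate:
  obtains h where "0 < h" "\<And>x. x \<in> X \<Longrightarrow> norm (velocity x) \<le> 2 / h * norm (\<Phi> h x - x)"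
    "\<And>x. x \<in> X \<Longrightarrow> ((\<lambda>t. \<Phi> t x) has_vector_derivative velocity x) (at 0)"
proof -
  obtain h where h: "0 < h" "h \<le> 1"
    "\<And>s x v. 0 \<le> s \<Longrightarrow> s \<le> h \<Longrightarrow> x \<in> X \<Longrightarrow> norm (D s x v - v) \<le> norm v / 2"
    using D_near_identity by metis
  have "((\<lambda>t. \<Phi> t x) has_vector_derivative velocity x) (at 0) \<and> norm (velocity x) \<le> 2 / h * norm (\<Phi> h x - x)"
    if x: "x \<in> X" for x
  proof -
    obtain w where w: "((\<lambda>t. \<Phi> t x) has_vector_derivative w) (at 0)" "norm w \<le> 2 / h * norm (\<Phi> h x - x)"
      using flow_time_derivative_at_0[OF h(1,2), of x] h(3)[OF _ _ x] by blast
    moreover have "velocity x = w" unfolding velocity_def by (rule vector_derivative_at[OF w(1)])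
    ultimately show ?thesis by simp
  qed
  then show thesis using that h(1) by blast
qed

lemma flow_time_derivative:
  assumes "x \<in> X"
  shows "((\<lambda>t. \<Phi> t x) has_vector_derivative D t x (velocity x)) (at t)"
proof -
  have d0: "((\<lambda>t. \<Phi> t x) has_vector_derivative velocity x) (at 0)"
    using velocity_estimate assms by metis
  have "((\<lambda>r. \<Phi> (r - t) x) has_derivative (\<lambda>r. r *\<^sub>R velocity x)) (at t)"
  proof (rule has_derivative_compose[where f = "\<lambda>r. r - t" and f' = "\<lambda>r. r" and g = "\<lambda>t. \<Phi> t x"])
    show "((\<lambda>r. r - t) has_derivative (\<lambda>r. r)) (at t)" by (auto intro!: derivative_eq_intros)
    show "((\<lambda>t. \<Phi> t x) has_derivative (\<lambda>r. r *\<^sub>R velocity x)) (at (t - t))"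
      using d0 by (simp add: has_vector_derivative_def)
  qed
  then have "((\<lambda>r. \<Phi> t (\<Phi> (r - t) x)) has_derivative (\<lambda>r. D t (\<Phi> (t - t) x) (r *\<^sub>R velocity x))) (at t)"
    by (rule has_derivative_compose) (rule flow_derivative)
  moreover have "\<Phi> t (\<Phi> (r - t) x) = \<Phi> r x" for r using flow_add[of t "r - t" x] by simp
  ultimately show ?thesis by (simp add: has_vector_derivative_def flow_0 blinfun.scaleR_right)
qed

text \<open>This makes the separation estimate for \<open>D\<close> applicable to the velocity along
  an orbit.\<close>

lemma velocity_flow:
  assumes "x \<in> X"
  shows "velocity (\<Phi> t x) = D t x (velocity x)"
proof -
  have "((\<lambda>s. \<Phi> (s + t) x) has_derivative (\<lambda>s. s *\<^sub>R D t x (velocity x))) (at 0)"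
  proof (rule has_derivative_compose[where f = "\<lambda>s. s + t" and f' = "\<lambda>s. s" and g = "\<lambda>t. \<Phi> t x"])
    show "((\<lambda>s. s + t) has_derivative (\<lambda>s. s)) (at 0)" by (auto intro!: derivative_eq_intros)
    show "((\<lambda>t. \<Phi> t x) has_derivative (\<lambda>s. s *\<^sub>R D t x (velocity x))) (at (0 + t))"
      using flow_time_derivative[OF assms, of t] by (simp add: has_vector_derivative_def)
  qed
  then have "((\<lambda>s. \<Phi> s (\<Phi> t x)) has_vector_derivative D t x (velocity x)) (at 0)"
    unfolding has_vector_derivative_def by (simp add: flow_add)
  then show ?thesis unfolding velocity_def by (rule vector_derivative_at)
qed

lemma displacement_le_velocity:
  assumes "0 < r"
  obtains L where "0 < L" "\<And>x s. x \<in> X \<Longrightarrow> 0 \<le> s \<Longrightarrow> s \<le> r \<Longrightarrow> norm (\<Phi> s x - x) \<le> L * norm (velocity x)"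
proof -
  obtain B where B: "1 \<le> B" "\<And>s x. 0 \<le> s \<Longrightarrow> s \<le> r \<Longrightarrow> x \<in> X \<Longrightarrow> norm (D s x) \<le> B"
    using D_bounded[of r] by metis
  show thesis
  proof (rule that[of "B * r"])
    show "0 < B * r" using B assms by simp
    fix x s assume x: "x \<in> X" and s: "0 \<le> s" "s \<le> r"
    have "norm (\<Phi> s x - \<Phi> 0 x) \<le> (B * norm (velocity x)) * norm (s - 0)"
    proof (rule differentiable_bound[of "{0..r}"])
      show "((\<lambda>t. \<Phi> t x) has_derivative (\<lambda>h. h *\<^sub>R D t x (velocity x))) (at t within {0..r})" for t
        using flow_time_derivative[OF x, of t] unfolding has_vector_derivative_def
        by (rule has_derivative_at_withinI)
      show "onorm (\<lambda>h. h *\<^sub>R D t x (velocity x)) \<le> B * norm (velocity x)" if "t \<in> {0..r}" for t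
      proof (rule onorm_le)
        fix h :: real
        have "norm (D t x (velocity x)) \<le> norm (D t x) * norm (velocity x)" by (rule norm_blinfun)
        also have "\<dots> \<le> B * norm (velocity x)" using B(2)[of t x] that x by (intro mult_right_mono) auto
        finally show "norm (h *\<^sub>R D t x (velocity x)) \<le> B * norm (velocity x) * norm h"
          by (simp add: mult.commute mult_left_mono)
      qed
    qed (use s in auto)
    also have "\<dots> \<le> (B * norm (velocity x)) * r" using s B by (intro mult_left_mono) auto
    finally show "norm (\<Phi> s x - x) \<le> B * r * norm (velocity x)" by (simp add: flow_0 mult_ac)
  qed
qed

section \<open>Orbits with summable velocity\<close>

text \<open>Displacements over time at most \<open>r\<close> are bounded by a multiple of the
  velocity at the start. Hence the orbit sampled at multiples of \<open>r\<close> converges, and the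
  excursions between samples tend to 0. Continuity of the flow makes the limit an
  equilibrium.\<close>

lemma summable_velocity_imp_convergent:
  assumes x: "x \<in> X" and r: "0 < r" and sm: "summable (\<lambda>i. norm (velocity (\<Phi> (real i * r) x)))"
  obtains e where "e \<in> X" "\<forall>t. \<Phi> t e = e" "((\<lambda>t. \<Phi> t x) \<longlongrightarrow> e) at_top"
proof -
  define z where "z i = \<Phi> (real i * r) x" for i
  have zX: "z i \<in> X" for i unfolding z_def using x r by (intro X_invariant) auto
  obtain L where L: "0 < L" "\<And>x s. x \<in> X \<Longrightarrow> 0 \<le> s \<Longrightarrow> s \<le> r \<Longrightarrow> norm (\<Phi> s x - x) \<le> L * norm (velocity x)"
    using displacement_le_velocity[OF r] by metis
  have zS: "z (Suc i) = \<Phi> r (z i)" for i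
    using flow_add[of r "real i * r" x] by (simp add: z_def algebra_simps)
  have sL: "summable (\<lambda>i. L * norm (velocity (z i)))" using sm unfolding z_def by (rule summable_mult)
  have "summable (\<lambda>i. norm (z (Suc i) - z i))"
    by (rule summable_comparison_test[OF _ sL]) (use L(2)[OF zX, of r] r zS in auto)
  then have "summable (\<lambda>i. z (Suc i) - z i)" by (rule summable_norm_cancel)
  then have "convergent (\<lambda>n. \<Sum>i<n. z (Suc i) - z i)" by (simp add: summable_iff_convergent)
  then have "convergent (\<lambda>n. z n - z 0)" by (simp add: sum_lessThan_telescope)
  then obtain l where "(\<lambda>n. z n - z 0) \<longlonglongrightarrow> l" by (auto simp: convergent_def)
  then have "(\<lambda>n. (z n - z 0) + z 0) \<longlonglongrightarrow> l + z 0" by (intro tendsto_intros)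
  then obtain e where e: "z \<longlonglongrightarrow> e" by auto
  have eX: "e \<in> X" using closed_sequentially[OF compact_imp_closed[OF X_compact]] zX e by blast
  \<comment> \<open>The index of the last sampling time before \<open>t\<close>.\<close>
  define i where "i t = nat \<lfloor>t / r\<rfloor>" for t
  have itop: "filterlim i at_top at_top"
  proof -
    have "filterlim (\<lambda>t. t / r) at_top at_top"
      using r by (intro filterlim_at_top_mult_tendsto_pos[of "\<lambda>t. 1/r" "1/r" at_top "\<lambda>t. t", simplified]) (auto simp: filterlim_ident)
    then show ?thesis unfolding i_def
      using filterlim_compose[OF filterlim_nat_sequentially] filterlim_compose[OF filterlim_floor_sequentially] by blast
  qed
  have lim: "((\<lambda>t. \<Phi> t x) \<longlongrightarrow> e) at_top"
  proof -
    have "((\<lambda>t. \<Phi> t x - z (i t)) \<longlongrightarrow> 0) at_top"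
    proof (rule Lim_null_comparison)
      show "\<forall>\<^sub>F t in at_top. norm (\<Phi> t x - z (i t)) \<le> L * norm (velocity (z (i t)))"
      proof (rule eventually_at_top_linorderI[of 0])
        fix t :: real assume t: "0 \<le> t"
        define s where "s = t - real (i t) * r"
        have fl: "real (i t) = of_int \<lfloor>t / r\<rfloor>" using t r by (simp add: i_def)
        have "real (i t) \<le> t / r" "t / r < real (i t) + 1" unfolding fl by linarith+
        then have s: "0 \<le> s" "s \<le> r" using r by (auto simp: s_def field_simps)
        have "\<Phi> t x = \<Phi> s (z (i t))" using flow_add[of s "real (i t) * r" x] by (simp add: s_def z_def)
        then show "norm (\<Phi> t x - z (i t)) \<le> L * norm (velocity (z (i t)))" using L(2)[OF zX s] by simp
      qed
      show "((\<lambda>t. L * norm (velocity (z (i t)))) \<longlongrightarrow> 0) at_top"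
        by (rule filterlim_compose[OF summable_LIMSEQ_zero[OF sL] itop])
    qed
    then have "((\<lambda>t. (\<Phi> t x - z (i t)) + z (i t)) \<longlongrightarrow> 0 + e) at_top"
      by (intro tendsto_add filterlim_compose[OF e itop])
    then show ?thesis by simp
  qed
  have "\<Phi> s e = e" for s
  proof -
    have "isCont (\<Phi> s) e" using has_derivative_continuous[OF flow_derivative] by blast
    then have "((\<lambda>t. \<Phi> s (\<Phi> t x)) \<longlongrightarrow> \<Phi> s e) at_top" using lim by (rule isCont_tendsto_compose)
    moreover have "((\<lambda>t. \<Phi> (s + t) x) \<longlongrightarrow> e) at_top"
      by (rule filterlim_compose[OF lim]) (rule filterlim_tendsto_add_at_top[OF tendsto_const filterlim_ident])
    ultimately show ?thesis by (simp add: flow_add tendsto_unique[OF trivial_limit_at_top_linorder])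
  qed
  then show thesis using that eX lim by blast
qed

section \<open>Velocity and pseudo-ordered orbits\<close>

text \<open>The difference quotients converge to the velocity, which lies in the open set
  \<open>interior C - {0}\<close>; a quotient at a small positive time therefore lies there too and
  orders two points of the orbit.\<close>

lemma velocity_in_cone_imp_pseudo_ordered:
  assumes x: "x \<in> X" and v: "velocity x \<in> interior C" "velocity x \<noteq> 0"
  shows "x \<in> pseudo_ordered_set \<Phi> C"
proof -
  have "((\<lambda>t. \<Phi> t x) has_vector_derivative velocity x) (at 0)"
    using velocity_estimate x by metis
  then have "((\<lambda>t. norm (\<Phi> (0 + t) x - \<Phi> 0 x - t *\<^sub>R velocity x) / norm t) \<longlongrightarrow> 0) (at 0)"
    unfolding has_vector_derivative_def has_derivative_at by blast
  then have "((\<lambda>t. norm ((\<Phi> t x - x) /\<^sub>R t - velocity x)) \<longlongrightarrow> 0) (at 0)"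
  proof (rule Lim_transform_eventually)
    show "\<forall>\<^sub>F t in at 0. norm (\<Phi> (0 + t) x - \<Phi> 0 x - t *\<^sub>R velocity x) / norm t = norm ((\<Phi> t x - x) /\<^sub>R t - velocity x)"
      unfolding eventually_at_filter
    proof (intro always_eventually allI impI)
      fix t :: real assume t: "t \<noteq> 0"
      then have "(\<Phi> t x - x) /\<^sub>R t - velocity x = (\<Phi> t x - x - t *\<^sub>R velocity x) /\<^sub>R t"
        by (simp add: scaleR_diff_right)
      then show "norm (\<Phi> (0 + t) x - \<Phi> 0 x - t *\<^sub>R velocity x) / norm t = norm ((\<Phi> t x - x) /\<^sub>R t - velocity x)"
        by (simp add: flow_0 divide_inverse mult.commute)
    qed
  qed
  then have lim: "((\<lambda>t. (\<Phi> t x - x) /\<^sub>R t) \<longlongrightarrow> velocity x) (at 0)"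
    by (rule LIM_zero_cancel[OF tendsto_norm_zero_cancel])
  have "open (interior C - {0})" by (intro open_Diff) auto
  then have "\<forall>\<^sub>F t in at 0. (\<Phi> t x - x) /\<^sub>R t \<in> interior C - {0}"
    using lim v by (intro topological_tendstoD) auto
  then have "\<forall>\<^sub>F t in at_right 0. (\<Phi> t x - x) /\<^sub>R t \<in> interior C - {0} \<and> 0 < t"
    by (intro eventually_conj eventually_at_right_less) (auto simp: eventually_at_split)
  then obtain t where t: "(\<Phi> t x - x) /\<^sub>R t \<in> interior C - {0}" "0 < t"
    using eventually_happens'[OF trivial_limit_at_right_real] by blast
  have "t *\<^sub>R ((\<Phi> t x - x) /\<^sub>R t) \<in> C" using t interior_subset cone_scale by blast
  then have "\<Phi> t x - \<Phi> 0 x \<in> C" using t by (simp add: flow_0)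
  moreover have "\<Phi> t x \<noteq> \<Phi> 0 x" using t by (auto simp: flow_0)
  ultimately show ?thesis unfolding pseudo_ordered_set_def using t(2) by (intro CollectI exI[of _ t] exI[of _ 0]) auto
qed

lemma pseudo_ordered_flow:
  assumes "\<Phi> s x \<in> pseudo_ordered_set \<Phi> C" "0 \<le> s"
  shows "x \<in> pseudo_ordered_set \<Phi> C"
proof -
  obtain t1 t2 where "0 \<le> t1" "0 \<le> t2" "\<Phi> (t1 + s) x \<noteq> \<Phi> (t2 + s) x" "\<Phi> (t1 + s) x - \<Phi> (t2 + s) x \<in> C"
    using assms(1) unfolding pseudo_ordered_set_def by (auto simp: flow_add)
  then show ?thesis unfolding pseudo_ordered_set_def using assms(2)
    by (intro CollectI exI[of _ "t1 + s"] exI[of _ "t2 + s"]) auto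
qed

lemma open_pseudo_ordered: "open (pseudo_ordered_set \<Phi> C)"
proof (rule openI)
  fix x assume "x \<in> pseudo_ordered_set \<Phi> C"
  then obtain t1 t2 where t: "0 \<le> t1" "0 \<le> t2" "\<Phi> t1 x \<noteq> \<Phi> t2 x" "\<Phi> t1 x - \<Phi> t2 x \<in> C"
    unfolding pseudo_ordered_set_def by auto
  \<comment> \<open>One unit of extra time turns the order relation into a strict one, which is an
    open condition on the initial point.\<close>
  define f where "f y = \<Phi> (1 + t1) y - \<Phi> (1 + t2) y" for y
  have "continuous_on UNIV f" unfolding f_def by (intro continuous_intros continuous_flow_comp)
  then have op: "open (f -` (interior C - {0}))" by (intro open_vimage) auto
  have "f x \<in> interior C" unfolding f_def flow_add by (intro flow_strict t) auto
  moreover have "f x \<noteq> 0" using t(3) by (simp add: f_def flow_add flow_inj)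
  ultimately have "x \<in> f -` (interior C - {0})" by simp
  moreover have "f -` (interior C - {0}) \<subseteq> pseudo_ordered_set \<Phi> C"
  proof
    fix y assume "y \<in> f -` (interior C - {0})"
    then show "y \<in> pseudo_ordered_set \<Phi> C"
      unfolding pseudo_ordered_set_def f_def using t interior_subset[of C]
      by (intro CollectI exI[of _ "1 + t1"] exI[of _ "1 + t2"]) auto
  qed
  ultimately show "\<exists>e>0. ball x e \<subseteq> pseudo_ordered_set \<Phi> C"
    using op open_contains_ball by (metis subset_trans)
qed

text \<open>Zero is listed separately because it belongs to the interior of \<open>C\<close> when
  \<open>C\<close> is the whole space.\<close>

lemma velocity_outside_cone:
  assumes x: "x \<in> X" and Q: "x \<notin> pseudo_ordered_set \<Phi> C" and t: "0 \<le> t"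
  shows "velocity (\<Phi> t x) = 0 \<or> velocity (\<Phi> t x) \<notin> interior C"
  using velocity_in_cone_imp_pseudo_ordered[OF X_invariant[OF x t]] pseudo_ordered_flow[OF _ t, of x] Q by blast

end

subsection \<open>Convergence to equilibria\<close>

text \<open>Used with \<open>K\<close> a compact set of pairs of a point and a unit vector that
  violate an estimate: if the estimate holds at \<open>e\<close>, it holds for all points within
  distance \<open>r\<close> of \<open>e\<close>.\<close>

lemma compact_fst_separated:
  fixes K :: "('a::metric_space \<times> 'b::metric_space) set"
  assumes "compact K" "\<And>q. q \<in> K \<Longrightarrow> fst q \<noteq> e"
  obtains r where "0 < r" "\<And>q. q \<in> K \<Longrightarrow> r < dist (fst q) e"
proof (cases "K = {}")
  case False
  have "continuous_on K (\<lambda>q. dist (fst q) e)" by (intro continuous_intros)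
  then obtain q0 where q0: "q0 \<in> K" "\<And>q. q \<in> K \<Longrightarrow> dist (fst q0) e \<le> dist (fst q) e"
    using continuous_attains_inf[OF assms(1) False] by blast
  have "0 < dist (fst q0) e" using assms(2)[OF q0(1)] by simp
  moreover have "dist (fst q0) e / 2 < dist (fst q) e" if "q \<in> K" for q
    using q0(2)[OF that] \<open>0 < dist (fst q0) e\<close> by linarith
  ultimately show thesis using that[of "dist (fst q0) e / 2"] by simp
qed (use that[of 1] in auto)

context cone_flow
begin

lemma continuous_D_apply:
  "continuous_on S (\<lambda>q. D t (fst q) (snd q))"
  by (intro continuous_intros continuous_D_comp)

text \<open>If every unit vector of \<open>C\<close> were expanded at \<open>e\<close> by more than
  \<open>2 / p ^ n\<close>, points near \<open>e\<close> would expand \<open>C\<close> at least by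
  \<open>a\<close>. The orbit stays near \<open>e\<close>, so iteration gives growth like
  \<open>(3/2) ^ i / p ^ (i * n)\<close>, too fast for the slow expansion at
  \<open>x\<close>.\<close>

lemma slow_expansion_at_limit:
  assumes x: "x \<in> X" and lim: "((\<lambda>t. \<Phi> t x) \<longlongrightarrow> e) at_top" and n: "1 \<le> n" and p: "0 < p" "p < 1"
    and slow: "\<And>j. \<exists>w\<in>C. norm w = 1 \<and> p ^ j * norm (D (real j) x w) \<le> K"
  shows "\<exists>v\<in>C. norm v = 1 \<and> norm (D (real n) e v) \<le> 2 / p ^ n"
proof (rule ccontr)
  assume "\<not> ?thesis"
  then have big: "norm (D (real n) e v) > 2 / p ^ n" if "v \<in> C" "norm v = 1" for v
    using that by force
  \<comment> \<open>Any factor strictly between \<open>1 / p ^ n\<close> and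
    \<open>2 / p ^ n\<close> works: it survives a small perturbation of \<open>e\<close> and still
    beats \<open>p\<close>.\<close>
  define a where "a = 3 / 2 / p ^ n"
  define Z where "Z = (X \<times> (C \<inter> sphere 0 1)) \<inter> {q. norm (D (real n) (fst q) (snd q)) \<le> a}"
  have "compact Z" unfolding Z_def
    by (intro compact_Int_closed compact_Times X_compact closed_Int_compact cone_closed compact_sphere
        closed_Collect_le continuous_intros continuous_D_apply)
  moreover have "fst q \<noteq> e" if "q \<in> Z" for q
    using that big[of "snd q"] p by (auto simp: Z_def a_def field_simps)
  ultimately obtain r where r: "0 < r" "\<And>q. q \<in> Z \<Longrightarrow> r < dist (fst q) e"
    using compact_fst_separated by metis
  have grow: "a * norm v \<le> norm (D (real n) z v)" if z: "z \<in> X" "dist z e \<le> r" and v: "v \<in> C" for z v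
  proof (cases "v = 0")
    case False
    define u where "u = (1 / norm v) *\<^sub>R v"
    have u: "u \<in> C" "norm u = 1" using v False cone_scale by (auto simp: u_def)
    have "(z, u) \<notin> Z" using r(2)[of "(z,u)"] z by auto
    then have "a < norm (D (real n) z u)" using z u by (auto simp: Z_def)
    also have "\<dots> = norm (D (real n) z v) / norm v" by (simp add: u_def blinfun.scaleR_right)
    finally show ?thesis using False by (simp add: field_simps)
  qed simp
  have "\<forall>\<^sub>F t in at_top. dist (\<Phi> t x) e < r" using lim r(1) by (rule tendstoD)
  then obtain T0 where T0: "\<And>t. T0 \<le> t \<Longrightarrow> dist (\<Phi> t x) e < r" by (auto simp: eventually_at_top_linorder)
  \<comment> \<open>A whole number of time units after which the orbit stays near \<open>e\<close>;
    the expansion up to then is bounded below by \<open>b\<close>.\<close>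
  define N where "N = nat \<lceil>T0\<rceil>"
  have N: "T0 \<le> real N" unfolding N_def by (rule real_nat_ceiling_ge)
  obtain b where b: "0 < b" "\<And>x v. x \<in> X \<Longrightarrow> b * norm v \<le> norm (D (real N) x v)"
    using D_expand_lower[of "real N"] by auto
  have a0: "0 \<le> a" using p by (simp add: a_def)
  have it: "a ^ i * (b * norm w) \<le> norm (D (real (N + i * n)) x w)" if w: "w \<in> C" for i w
  proof (induction i)
    case 0 then show ?case using b(2)[OF x] by simp
  next
    case (Suc i)
    let ?t = "real (N + i * n)"
    have Nt: "0 \<le> ?t" "T0 \<le> ?t" using N by (simp_all add: add_increasing2)
    have "a ^ Suc i * (b * norm w) \<le> a * norm (D ?t x w)" using mult_left_mono[OF Suc a0] by (simp add: mult_ac)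
    also have "\<dots> \<le> norm (D (real n) (\<Phi> ?t x) (D ?t x w))"
      by (intro grow X_invariant x D_cone w Nt less_imp_le[OF T0[OF Nt(2)]])
    also have "\<dots> = norm (D (real (N + Suc i * n)) x w)"
      using D_add[of "real n" ?t x w] by (simp add: algebra_simps)
    finally show ?case .
  qed
  obtain i where i: "(3/2) ^ i > K / (p ^ N * b)" using real_arch_pow[of "3/2::real" "K / (p ^ N * b)"] by auto
  obtain w where w: "w \<in> C" "norm w = 1" "p ^ (N + i * n) * norm (D (real (N + i * n)) x w) \<le> K"
    using slow by blast
  have "p ^ (N + i * n) * (a ^ i * (b * norm w)) \<le> K"
    using order_trans[OF mult_left_mono[OF it[OF w(1)]] w(3)] p by simp
  moreover have "p ^ (N + i * n) * a ^ i = p ^ N * (3/2) ^ i"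
  proof -
    have "p ^ n * a = 3/2" using p by (simp add: a_def)
    then have "(p ^ n) ^ i * a ^ i = (3/2) ^ i" by (metis power_mult_distrib)
    then show ?thesis by (simp add: power_add power_mult mult.commute[of i n] mult.assoc)
  qed
  ultimately have "p ^ N * (3/2) ^ i * b \<le> K" using w(2) by (simp add: mult.assoc[symmetric])
  then show False using i p b(1) by (simp add: field_simps)
qed

text \<open>The contraction by \<open>1/2\<close> persists near \<open>e\<close> as a contraction by
  \<open>3/4\<close>. While the orbit stays near \<open>e\<close> its velocity decays geometrically,
  so the total displacement is small and the orbit cannot leave the neighbourhood.\<close>

lemma contracting_equilibrium_attracts:
  assumes e: "e \<in> X" "\<forall>t. \<Phi> t e = e" and n: "1 \<le> n"
    and contr: "\<And>u. D (real n) e u \<notin> interior C \<Longrightarrow> norm (D (real n) e u) \<le> norm u / 2"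
  obtains \<delta> where "0 < \<delta>"
    "\<And>y. y \<in> X \<Longrightarrow> dist y e < \<delta> \<Longrightarrow>
      (\<forall>t\<ge>0. velocity (\<Phi> t y) = 0 \<or> velocity (\<Phi> t y) \<notin> interior C) \<Longrightarrow> y \<in> conv_equilibrium_set \<Phi>"
proof -
  define Z where "Z = (X \<times> sphere 0 1) \<inter> {q. 3/4 \<le> norm (D (real n) (fst q) (snd q))}
    \<inter> (\<lambda>q. D (real n) (fst q) (snd q)) -` (- interior C)"
  have "compact Z" unfolding Z_def
    by (intro compact_Int_closed compact_Times X_compact compact_sphere closed_vimage closed_Collect_le
        continuous_intros continuous_D_apply) auto
  moreover have "fst q \<noteq> e" if "q \<in> Z" for q
    using that contr[of "snd q"] by (auto simp: Z_def)
  ultimately obtain r where r: "0 < r" "\<And>q. q \<in> Z \<Longrightarrow> r < dist (fst q) e"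
    using compact_fst_separated by metis
  have near: "norm (D (real n) z u) \<le> 3/4 * norm u"
    if z: "z \<in> X" "dist z e \<le> r" and u: "D (real n) z u = 0 \<or> D (real n) z u \<notin> interior C" for z u
  proof (cases "D (real n) z u = 0")
    case False
    then have u0: "u \<noteq> 0" by (simp add: D_inj)
    define v where "v = (1 / norm u) *\<^sub>R u"
    have Dv: "D (real n) z v = (1 / norm u) *\<^sub>R D (real n) z u" by (simp add: v_def blinfun.scaleR_right)
    have "D (real n) z v \<notin> interior C"
    proof
      assume "D (real n) z v \<in> interior C"
      then have "norm u *\<^sub>R D (real n) z v \<in> interior C"
        using u0 by (intro interior_scaleR_mem[OF cone_scale']) auto
      then show False using u False u0 by (simp add: Dv)
    qed
    moreover have "(z, v) \<notin> Z" using r(2)[of "(z,v)"] z by auto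
    moreover have "norm v = 1" using u0 by (simp add: v_def)
    ultimately have "norm (D (real n) z v) < 3/4" using z by (auto simp: Z_def)
    then show ?thesis using u0 by (simp add: Dv field_simps)
  qed simp
  have rn: "0 < real n" using n by simp
  obtain L where L: "0 < L" "\<And>x s. x \<in> X \<Longrightarrow> 0 \<le> s \<Longrightarrow> s \<le> real n \<Longrightarrow> norm (\<Phi> s x - x) \<le> L * norm (velocity x)"
    using displacement_le_velocity[OF rn] by metis
  obtain h where h: "0 < h" "\<And>x. x \<in> X \<Longrightarrow> norm (velocity x) \<le> 2 / h * norm (\<Phi> h x - x)"
    using velocity_estimate by metis
  have "continuous_on UNIV (\<lambda>y. \<Phi> h y - y)" by (intro continuous_intros continuous_flow_comp)
  then have "isCont (\<lambda>y. \<Phi> h y - y) e" by (simp add: continuous_on_eq_continuous_at)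
  moreover have g0: "0 < r * h / (16 * L)" using r h L by simp
  ultimately obtain d where d: "0 < d" "\<And>y. dist y e < d \<Longrightarrow> dist (\<Phi> h y - y) (\<Phi> h e - e) < r * h / (16 * L)"
    unfolding continuous_at_eps_delta by blast
  show thesis
  \<comment> \<open>Within distance \<open>d\<close> the initial velocity is at most
    \<open>r / (8 * L)\<close>, so all later displacements add up to at most \<open>r / 2\<close>;
    starting within \<open>r / 2\<close> then keeps the samples within \<open>r\<close>.\<close>
  proof (rule that[of "min d (r/2)"])
    show "0 < min d (r/2)" using d r by simp
    fix y assume y: "y \<in> X" "dist y e < min d (r/2)"
      and out: "\<forall>t\<ge>0. velocity (\<Phi> t y) = 0 \<or> velocity (\<Phi> t y) \<notin> interior C"
    define z where "z i = \<Phi> (real i * real n) y" for i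
    have zX: "z i \<in> X" for i unfolding z_def by (intro X_invariant y) auto
    have zS: "z (Suc i) = \<Phi> (real n) (z i)" for i
      using flow_add[of "real n" "real i * real n" y] by (simp add: z_def algebra_simps)
    have z0: "z 0 = y" by (simp add: z_def flow_0)
    define w where "w = norm (velocity y)"
    have "norm (\<Phi> h y - y) < r * h / (16 * L)" using d(2)[of y] y(2) e(2) by simp
    then have "2 / h * norm (\<Phi> h y - y) \<le> 2 / h * (r * h / (16 * L))" using h by (intro mult_left_mono) auto
    then have "w \<le> 2 / h * (r * h / (16 * L))" using h(2)[OF y(1)] by (simp add: w_def)
    then have w: "4 * L * w \<le> r / 2" using h(1) L(1) by (simp add: field_simps)
    have w0: "0 \<le> L * w" using L by (simp add: w_def)
    \<comment> \<open>The term \<open>4 * L * w * (1 - (3/4) ^ i)\<close> is the sum of the first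
      \<open>i\<close> displacement bounds \<open>L * (3/4) ^ j * w\<close>.\<close>
    have ind: "norm (velocity (z i)) \<le> (3/4) ^ i * w \<and> dist (z i) e \<le> r / 2 + 4 * L * w * (1 - (3/4) ^ i)" for i
    proof (induction i)
      case 0 then show ?case using y by (simp add: z0 w_def)
    next
      case (Suc i)
      have "4 * (L * w) * (1 - (3/4) ^ i) \<le> 4 * (L * w)" using w0 by (intro mult_left_le) auto
      then have ir: "dist (z i) e \<le> r" using Suc w by (simp add: mult.assoc)
      have v: "velocity (z (Suc i)) = D (real n) (z i) (velocity (z i))"
        unfolding zS by (rule velocity_flow[OF zX])
      have "velocity (z (Suc i)) = 0 \<or> velocity (z (Suc i)) \<notin> interior C"
        unfolding z_def using out by (metis of_nat_0_le_iff mult_nonneg_nonneg)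
      then have "norm (velocity (z (Suc i))) \<le> 3/4 * norm (velocity (z i))"
        unfolding v by (intro near zX ir)
      then have a: "norm (velocity (z (Suc i))) \<le> (3/4) ^ Suc i * w" using Suc by simp
      have "dist (z (Suc i)) (z i) \<le> L * norm (velocity (z i))"
        using L(2)[OF zX, of "real n"] by (simp add: zS dist_norm)
      also have "\<dots> \<le> L * ((3/4) ^ i * w)" using Suc L by (intro mult_left_mono) auto
      finally have "dist (z (Suc i)) (z i) \<le> L * ((3/4) ^ i * w)" .
      then have "dist (z (Suc i)) e \<le> r / 2 + 4 * L * w * (1 - (3/4) ^ i) + L * ((3/4) ^ i * w)"
        using dist_triangle[of "z (Suc i)" e "z i"] Suc by linarith
      also have "\<dots> = r / 2 + 4 * L * w * (1 - (3/4) ^ Suc i)" by (simp add: algebra_simps)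
      finally show ?case using a by simp
    qed
    have "summable (\<lambda>i. norm (velocity (z i)))"
    proof (rule summable_comparison_test)
      show "\<exists>N. \<forall>i\<ge>N. norm (norm (velocity (z i))) \<le> (3/4) ^ i * w" using ind by simp
      show "summable (\<lambda>i. (3/4) ^ i * w)" by (intro summable_mult2 summable_geometric) simp
    qed
    then obtain e' where "\<forall>t. \<Phi> t e' = e'" "((\<lambda>t. \<Phi> t y) \<longlongrightarrow> e') at_top"
      unfolding z_def using summable_velocity_imp_convergent[OF y(1) rn] by blast
    then show "y \<in> conv_equilibrium_set \<Phi>" unfolding conv_equilibrium_set_def by blast
  qed
qed

lemma conv_equilibrium_flow:
  assumes "\<Phi> s x \<in> conv_equilibrium_set \<Phi>"
  shows "x \<in> conv_equilibrium_set \<Phi>"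
proof -
  obtain e where e: "\<And>t. \<Phi> t e = e" "((\<lambda>t. \<Phi> t (\<Phi> s x)) \<longlongrightarrow> e) at_top"
    using assms unfolding conv_equilibrium_set_def by blast
  have "filterlim (\<lambda>t. - s + t) at_top at_top"
    by (rule filterlim_tendsto_add_at_top[OF tendsto_const filterlim_ident])
  then have "((\<lambda>t. \<Phi> (- s + t) (\<Phi> s x)) \<longlongrightarrow> e) at_top" by (rule filterlim_compose[OF e(2)])
  moreover have "\<Phi> (- s + t) (\<Phi> s x) = \<Phi> t x" for t using flow_add[of "- s + t" s x] by simp
  ultimately show ?thesis unfolding conv_equilibrium_set_def using e(1) by auto
qed

end

section \<open>Open sets of convergent points and density\<close>

lemma open_convergent_subset:
  fixes \<Phi> :: "real \<Rightarrow> real^'n \<Rightarrow> real^'n"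
  assumes flow: "cone_flow \<Phi> D C X"
    and W: "subspace W" "W \<subseteq> C" "w0 \<in> W" "w0 \<noteq> 0"
    and kC: "\<And>S. subspace S \<Longrightarrow> S \<subseteq> C \<Longrightarrow> dim S \<le> dim W"
    and U: "open U" "U \<noteq> {}" "U \<subseteq> X" "U \<inter> pseudo_ordered_set \<Phi> C = {}"
  obtains V where "open V" "V \<noteq> {}" "V \<subseteq> U" "V \<subseteq> conv_equilibrium_set \<Phi>"
proof -
  interpret cone_flow \<Phi> D C X by (rule flow)
  obtain u where u: "u \<in> U" using U by blast
  obtain P where P: "linear P" "\<And>x. P x \<in> W" "\<And>w. w \<in> W \<Longrightarrow> P w = w"
    "\<And>v. v \<in> C \<Longrightarrow> P v = 0 \<Longrightarrow> v = 0"
    using cone_projection[OF _ W kC, of u] u U(3) by blast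
  obtain M q where Mq: "0 < M" "0 < q" "q < 1" and
    sep: "\<And>x n u v. x \<in> X \<Longrightarrow> v \<in> C \<Longrightarrow> D (real n) x u \<notin> interior C \<Longrightarrow>
       norm (D (real n) x u) * norm v \<le> M * q ^ n * norm (D (real n) x v) * norm u"
    using exponential_separation by metis
  \<comment> \<open>Of the two factors in \<open>q ^ j = p ^ j * p ^ j\<close>, one pays for the
    expansion of \<open>C\<close> and the other remains as decay of the velocity.\<close>
  define p where "p = sqrt q"
  have p: "0 < p" "p < 1" and qp: "q = p * p" using Mq by (auto simp: p_def)
  have qn: "q ^ j = p ^ j * p ^ j" for j by (simp add: qp power_mult_distrib)
  define K0 where "K0 = C \<inter> sphere 0 1"
  have "compact K0" unfolding K0_def using cone_closed by (intro closed_Int_compact) auto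
  moreover have "(1 / norm w0) *\<^sub>R w0 \<in> K0" using W cone_scale by (auto simp: K0_def)
  moreover have "continuous_on K0 (\<lambda>v. norm (P v))"
    by (intro continuous_intros linear_continuous_on linear_conv_bounded_linear[THEN iffD1] P)
  ultimately obtain v0 where v0: "v0 \<in> K0" "\<And>v. v \<in> K0 \<Longrightarrow> norm (P v0) \<le> norm (P v)"
    using continuous_attains_inf[of K0 "\<lambda>v. norm (P v)"] by blast
  \<comment> \<open>On \<open>C\<close> the norm is controlled by \<open>P\<close>, so slow
    expansion after projection is slow expansion itself.\<close>
  define c where "c = norm (P v0)"
  have c: "0 < c" using v0(1) P(4)[of v0] by (auto simp: c_def K0_def)
  have Pc: "c * norm v \<le> norm (P v)" if "v \<in> C" for v
  proof (cases "v = 0")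
    case False
    then have "(1 / norm v) *\<^sub>R v \<in> K0" using that cone_scale by (auto simp: K0_def)
    then have "c \<le> norm (P ((1 / norm v) *\<^sub>R v))" unfolding c_def by (rule v0(2))
    also have "\<dots> = norm (P v) / norm v" by (simp add: linear_scale[OF P(1)])
    finally show ?thesis using False by (simp add: field_simps)
  qed simp
  obtain R where R: "\<And>x. x \<in> X \<Longrightarrow> norm x \<le> R" using compact_imp_bounded[OF X_compact] bounded_iff by blast
  have UX: "x \<in> X" if "x \<in> U" for x using U(3) that by blast
  obtain x K where xU: "x \<in> U" and
    K: "\<And>j. \<exists>w. P w = w \<and> norm w = 1 \<and> p ^ j * norm (P (D (real j) x w)) \<le> K"
  proof (rule exists_point_slow_expansion[of P w0 U p "\<lambda>j. \<Phi> (real j)" R "\<lambda>j x. blinfun_apply (D (real j) x)"])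
    \<comment> \<open>Points of one coset of \<open>W\<close> differ by a vector of
      \<open>C\<close>. Their images stay ordered, and a vector of \<open>C\<close> killed by
      \<open>P\<close> is 0.\<close>
    show "x = y" if xy: "x \<in> U" "y \<in> U" "x - P x = y - P y" "P (\<Phi> (real j) x) = P (\<Phi> (real j) y)" for j x y
    proof -
      have "x - y = P (x - y)" using xy(3) by (simp add: linear_diff[OF P(1)] algebra_simps)
      then have "x - y \<in> C" using P(2)[of "x - y"] W(2) by auto
      then have "\<Phi> (real j) x - \<Phi> (real j) y \<in> C" by (intro flow_cone) auto
      then have "\<Phi> (real j) x - \<Phi> (real j) y = 0" by (rule P(4)) (simp add: linear_diff[OF P(1)] xy(4))
      then show ?thesis using flow_inj by simp
    qed
    show "bounded U" using bounded_subset[OF compact_imp_bounded[OF X_compact] U(3)] .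
    show "continuous_on U (\<lambda>x. D (real j) x v)" for j v
      by (intro continuous_intros continuous_D_comp)
    show "norm (\<Phi> (real j) x) \<le> R" if "x \<in> U" for j x
      by (intro R X_invariant UX that) simp
    show "(\<Phi> (real j) has_derivative blinfun_apply (D (real j) x)) (at x)" for j x
      by (rule flow_derivative)
  qed (use P W U p in auto)
  have xX: "x \<in> X" using UX[OF xU] .
  have slow: "\<exists>w\<in>C. norm w = 1 \<and> p ^ j * norm (D (real j) x w) \<le> K / c" for j
  proof -
    obtain w where w: "P w = w" "norm w = 1" "p ^ j * norm (P (D (real j) x w)) \<le> K" using K by blast
    have wC: "w \<in> C" using P(2)[of w] w(1) W(2) by auto
    have "p ^ j * (c * norm (D (real j) x w)) \<le> K"
      using order_trans[OF mult_left_mono[OF Pc[OF D_cone[OF wC]]] w(3)] p by simp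
    then have "p ^ j * norm (D (real j) x w) \<le> K / c" using c by (simp add: field_simps)
    then show ?thesis using wC w(2) by blast
  qed
  have outU: "velocity (\<Phi> t y) = 0 \<or> velocity (\<Phi> t y) \<notin> interior C" if "y \<in> U" "0 \<le> t" for y t
    using velocity_outside_cone[OF UX[OF that(1)] _ that(2)] U(4) that(1) by blast
  have decay: "norm (velocity (\<Phi> (real j * 1) x)) \<le> p ^ j * (M * (K / c) * norm (velocity x))" for j
  proof -
    obtain w where w: "w \<in> C" "norm w = 1" "p ^ j * norm (D (real j) x w) \<le> K / c" using slow by blast
    have "norm (D (real j) x (velocity x)) \<le> M * q ^ j * norm (D (real j) x w) * norm (velocity x)"
    proof (cases "D (real j) x (velocity x) = 0")
      case False
      then have "D (real j) x (velocity x) \<notin> interior C"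
        using outU[OF xU, of "real j"] velocity_flow[OF xX, of "real j"] by simp
      then show ?thesis using sep[OF xX w(1)] w(2) by simp
    qed (use Mq in simp)
    also have "\<dots> = p ^ j * M * norm (velocity x) * (p ^ j * norm (D (real j) x w))" by (simp add: qn mult_ac)
    also have "\<dots> \<le> p ^ j * M * norm (velocity x) * (K / c)"
      using w(3) p Mq by (intro mult_left_mono) auto
    finally show ?thesis using velocity_flow[OF xX, of "real j"] by (simp add: mult_ac)
  qed
  have "summable (\<lambda>i. norm (velocity (\<Phi> (real i * 1) x)))"
  proof (rule summable_comparison_test)
    show "\<exists>N. \<forall>j\<ge>N. norm (norm (velocity (\<Phi> (real j * 1) x))) \<le> p ^ j * (M * (K / c) * norm (velocity x))"
      using decay by simp
    show "summable (\<lambda>j. p ^ j * (M * (K / c) * norm (velocity x)))"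
      using p by (intro summable_mult2 summable_geometric) simp
  qed
  then obtain e where e: "e \<in> X" "\<forall>t. \<Phi> t e = e" "((\<lambda>t. \<Phi> t x) \<longlongrightarrow> e) at_top"
    by (rule summable_velocity_imp_convergent[OF xX zero_less_one])
  \<comment> \<open>At \<open>e\<close> separation contributes \<open>M * q ^ n\<close> and slow
    expansion \<open>2 / p ^ n\<close>; the product \<open>2 * M * p ^ n\<close> has to be at most
    \<open>1/2\<close>. The successor ensures a positive time.\<close>
  obtain n0 where n0: "p ^ n0 < 1 / (4 * M)" using real_arch_pow_inv[of "1 / (4*M)" p] p Mq by auto
  define n where "n = Suc n0"
  have "p ^ n \<le> p ^ n0" unfolding n_def using p by (intro power_decreasing) auto
  then have "M * p ^ n \<le> M * p ^ n0" using Mq by (intro mult_left_mono) auto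
  moreover have "M * p ^ n0 < 1/4" using n0 Mq by (simp add: field_simps)
  ultimately have pn: "2 * M * p ^ n \<le> 1/2" by linarith
  have n1: "1 \<le> n" by (simp add: n_def)
  obtain v where v: "v \<in> C" "norm v = 1" "norm (D (real n) e v) \<le> 2 / p ^ n"
    using slow_expansion_at_limit[OF xX e(3) n1 p slow] by blast
  have contr: "norm (D (real n) e u) \<le> norm u / 2" if "D (real n) e u \<notin> interior C" for u
  proof -
    have "norm (D (real n) e u) \<le> M * q ^ n * norm (D (real n) e v) * norm u"
      using sep[OF e(1) v(1) that] v(2) by simp
    also have "\<dots> \<le> M * q ^ n * (2 / p ^ n) * norm u"
      using v(3) Mq by (intro mult_right_mono mult_left_mono) auto
    also have "\<dots> = 2 * M * p ^ n * norm u" using p by (simp add: qn)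
    also have "\<dots> \<le> 1/2 * norm u" using pn by (intro mult_right_mono) auto
    finally show ?thesis by simp
  qed
  obtain \<delta> where d: "0 < \<delta>"
    "\<And>y. y \<in> X \<Longrightarrow> dist y e < \<delta> \<Longrightarrow>
      (\<forall>t\<ge>0. velocity (\<Phi> t y) = 0 \<or> velocity (\<Phi> t y) \<notin> interior C) \<Longrightarrow> y \<in> conv_equilibrium_set \<Phi>"
    using contracting_equilibrium_attracts[OF e(1,2) n1 contr] by metis
  have "\<forall>\<^sub>F t in at_top. dist (\<Phi> t x) e < \<delta>" using e(3) d(1) by (rule tendstoD)
  then obtain T1 where T1: "\<And>t. T1 \<le> t \<Longrightarrow> dist (\<Phi> t x) e < \<delta>" by (auto simp: eventually_at_top_linorder)
  define T where "T = max 0 T1"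
  have T: "0 \<le> T" "dist (\<Phi> T x) e < \<delta>" using T1[of T] by (auto simp: T_def)
  \<comment> \<open>Points of \<open>U\<close> that the flow carries near \<open>e\<close> at the
    same time \<open>T\<close> as \<open>x\<close>; convergence is then pulled back along the
    flow.\<close>
  define V where "V = U \<inter> \<Phi> T -` ball e \<delta>"
  show thesis
  proof (rule that[of V])
    have "continuous_on UNIV (\<Phi> T)"
      using continuous_flow_comp[of UNIV "\<lambda>_. T" "\<lambda>x. x"] by (simp add: continuous_on_id)
    then show "open V" unfolding V_def by (intro open_Int U(1) open_vimage) auto
    show "V \<noteq> {}" using xU T(2) by (auto simp: V_def dist_commute)
    show "V \<subseteq> U" by (auto simp: V_def)
    show "V \<subseteq> conv_equilibrium_set \<Phi>"
    proof
      fix y assume "y \<in> V"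
      then have y: "y \<in> U" "dist (\<Phi> T y) e < \<delta>" by (auto simp: V_def dist_commute)
      have "velocity (\<Phi> t (\<Phi> T y)) = 0 \<or> velocity (\<Phi> t (\<Phi> T y)) \<notin> interior C" if "0 \<le> t" for t
        using outU[OF y(1), of "t + T"] T(1) that by (simp add: flow_add)
      then have "\<Phi> T y \<in> conv_equilibrium_set \<Phi>"
        by (intro d(2) X_invariant UX y T) auto
      then show "y \<in> conv_equilibrium_set \<Phi>" by (rule conv_equilibrium_flow)
    qed
  qed
qed

theorem theorem5p1:
  fixes \<Phi> :: "real \<Rightarrow> real^'n \<Rightarrow> real^'n"
    and D :: "real \<Rightarrow> real^'n \<Rightarrow> ((real^'n) \<Rightarrow>\<^sub>L (real^'n))"
    and \<alpha> :: real and k :: nat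
    and C \<D> :: "(real^'n) set"
  assumes "FWW \<Phi> D \<alpha> k C"
    and "1 \<le> k"
    and "open \<D>" and "bounded \<D>"
    and "bounded (\<Union>x\<in>\<D>. orbit \<Phi> x)"
  shows "\<D> \<subseteq> closure (interior (pseudo_ordered_set \<Phi> C \<union> conv_equilibrium_set \<Phi>) \<inter> \<D>)"
proof -
  let ?Q = "pseudo_ordered_set \<Phi> C" and ?E = "conv_equilibrium_set \<Phi>"
  define O' where "O' = (\<Union>x\<in>\<D>. orbit \<Phi> x)"
  have FWW: "C1_alpha_flow \<Phi> D \<alpha>" "k_cone k C" "strongly_monotone \<Phi> C"
    "\<forall>t>0. \<forall>x. \<forall>v \<in> C - {0}. blinfun_apply (D t x) v \<in> interior C"
    using assms(1) unfolding FWW_def by - (elim conjE, assumption)+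
  have "\<forall>x. \<Phi> 0 x = x" "\<forall>s t x. \<Phi> (s + t) x = \<Phi> s (\<Phi> t x)"
    "continuous_on UNIV (\<lambda>(t, x). \<Phi> t x)" "\<forall>t x. (\<Phi> t has_derivative blinfun_apply (D t x)) (at x)"
    "continuous_on UNIV (\<lambda>(t, x). D t x)"
    using FWW(1) unfolding C1_alpha_flow_def is_flow_def by - (elim conjE, assumption)+
  note flow = this(1,2)[rule_format] this(3) this(4)[rule_format] this(5)
  have cone: "closed C" "\<And>v l. v \<in> C \<Longrightarrow> l *\<^sub>R v \<in> C" "\<And>S. subspace S \<Longrightarrow> S \<subseteq> C \<Longrightarrow> dim S \<le> k"
    using FWW(2) unfolding k_cone_def by blast+
  have invO: "\<Phi> t y \<in> O'" if y: "y \<in> O'" and t: "0 \<le> t" for t y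
  proof -
    obtain x s where xs: "x \<in> \<D>" "0 \<le> s" "y = \<Phi> s x" using y by (auto simp: O'_def orbit_def)
    have "\<Phi> t y = \<Phi> (t + s) x" by (simp add: xs(3) flow(2))
    then show ?thesis using xs t unfolding O'_def orbit_def by force
  qed
  interpret cone_flow \<Phi> D C "closure O'"
  proof
    show "compact (closure O')" using assms(5) by (simp add: O'_def compact_closure)
    show "\<Phi> t x \<in> closure O'" if "x \<in> closure O'" "0 \<le> t" for x t
    proof -
      have "continuous_on (closure O') (\<Phi> t)"
        using has_derivative_continuous[OF flow(4)] by (intro continuous_at_imp_continuous_on) blast
      then have "\<Phi> t ` closure O' \<subseteq> closure O'"
        by (rule image_closure_subset) (use invO that(2) closure_subset in auto)
      then show ?thesis using that(1) by blast
    qed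
    show "x - y \<in> C \<Longrightarrow> 0 \<le> t \<Longrightarrow> \<Phi> t x - \<Phi> t y \<in> C"
      "x \<noteq> y \<Longrightarrow> x - y \<in> C \<Longrightarrow> 0 < t \<Longrightarrow> \<Phi> t x - \<Phi> t y \<in> interior C" for x y t
      using FWW(3) unfolding strongly_monotone_def by blast+
    show "0 < t \<Longrightarrow> v \<in> C \<Longrightarrow> v \<noteq> 0 \<Longrightarrow> D t x v \<in> interior C" for t v x
      using FWW(4) by blast
  qed (fact flow(1) flow(2) flow(3) flow(4) flow(5) cone(1) cone(2))+
  obtain W where W: "subspace W" "W \<subseteq> C" "dim W = k" using FWW(2) unfolding k_cone_def by blast
  \<comment> \<open>A nonzero vector of \<open>W\<close>, supplied by \<open>1 \<le> k\<close>,
    makes the unit vectors of \<open>C\<close> a nonempty set and the projection nonzero.\<close>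
  have "\<not> W \<subseteq> {0}" using W(3) assms(2) dim_eq_0[of W] by auto
  then obtain w0 where w0: "w0 \<in> W" "w0 \<noteq> 0" by blast
  have DO: "\<D> \<subseteq> closure O'"
  proof
    fix x assume "x \<in> \<D>"
    then have "\<Phi> 0 x \<in> O'" unfolding O'_def orbit_def by blast
    then have "x \<in> O'" by (simp add: flow(1))
    then show "x \<in> closure O'" using closure_subset by blast
  qed
  show ?thesis
  proof
    fix x assume x: "x \<in> \<D>"
    show "x \<in> closure (interior (?Q \<union> ?E) \<inter> \<D>)"
      unfolding closure_iff_nhds_not_empty
    proof (intro allI impI)
      fix A S assume S: "S \<subseteq> A" "open S" "x \<in> S"
      define U where "U = S \<inter> \<D>"
      have U: "open U" "U \<noteq> {}" "U \<subseteq> closure O'" using S x assms(3) DO by (auto simp: U_def)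
      \<comment> \<open>If \<open>U\<close> meets the open set of pseudo-ordered points, the
        intersection serves as \<open>V\<close>; otherwise \<open>U\<close> contains an open set of
        convergent points.\<close>
      have "\<exists>V. open V \<and> V \<noteq> {} \<and> V \<subseteq> U \<and> V \<subseteq> ?Q \<union> ?E"
      proof (cases "U \<inter> ?Q = {}")
        case True
        obtain V where "open V" "V \<noteq> {}" "V \<subseteq> U" "V \<subseteq> ?E"
        proof (rule open_convergent_subset[OF cone_flow_axioms W(1,2) w0 _ U True])
          show "dim S \<le> dim W" if "subspace S" "S \<subseteq> C" for S
            using cone(3)[OF that] W(3) by simp
        qed
        then show ?thesis by (intro exI[of _ V]) auto
      next
        case False
        then show ?thesis using U(1) open_pseudo_ordered by (intro exI[of _ "U \<inter> ?Q"]) auto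
      qed
      then obtain V where V: "open V" "V \<noteq> {}" "V \<subseteq> U" "V \<subseteq> ?Q \<union> ?E" by blast
      have "V \<subseteq> interior (?Q \<union> ?E)" using V(1,4) by (simp add: interior_maximal)
      then show "(interior (?Q \<union> ?E) \<inter> \<D>) \<inter> A \<noteq> {}" using V(2,3) S(1) unfolding U_def by blast
    qed
  qed
qed

end
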